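(* The formulas $\mathcal{G}(\mathrm{BPHP}_n)$ admit $\mathsf{RAT}^-$ proofs of size $n^{O(1)}$, but every $\mathsf{SBC}^-$ proof of $\mathcal{G}(\mathrm{BPHP}_n)$ has size $2^{\Omega(n)}$.
   Context: A literal is a variable $v$ or its negation $\bar v$. A clause is a nontautological set of literals; $\bot$ is the empty clause; a formula is a finite set of clauses; $\mathrm{var}(\Gamma)$ is its set of variables. For a set $L$ of literals, $\bar L=\{\bar\ell:\ell\in L\}$. $D$ is a weakening of $C$ if $C\subseteq D$. If $C\cup\{x\}$, $D\cup\{\bar x\}$ are clauses with $x,\bar x\notin C\cup D$ and $C\cup D$ nontautological, $C\cup D$ is their resolvent. For a clause $C$ and formula $\Delta$, $C\vee\Delta=\{C\cup D: D\in\Delta,\ C\cup D \text{ nontautological}\}$. Resolution proof of $\Gamma$: sequence of formulas $(\Gamma_1,\dots,\Gamma_N)$, $\Gamma_1=\Gamma$, $\bot\in\Gamma_N$, each $\Gamma_{i+1}=\Gamma_i\cup\{C\}$ with $C$ a resolvent of two clauses of $\Gamma_i$ or a weakening of a clause of $\Gamma_i$; size $N$. A unit propagation proof is a resolution proof in which every resolution step has a premise consisting of a single literal. For a set of literals $L=\{\ell_1,\dots,\ell_k\}$, $\Gamma\vdash_1 L$ means there is a unit propagation proof of $\Gamma\cup\{\{\bar\ell_1\},\dots,\{\bar\ell_k\}\}$. A clause $C=\{p\}\cup C'$ ($p\notin C'$) is a resolution asymmetric tautology (RAT) for $p$ w.r.t. $\Gamma$ if for every clause $\{\bar p\}\cup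 D'\in\Gamma$ ($\bar p\notin D'$) we have $\Gamma\vdash_1 C'\cup D'$. $C$ is a set-blocked clause (SBC) for nonempty $L\subseteq C$ w.r.t. $\Gamma$ if for every $D\in\Gamma$ with $D\cap\bar L\ne\varnothing$, $D\cap L=\varnothing$, the set $(C\setminus L)\cup(D\setminus\bar L)$ is tautological. An $\mathsf{RAT}$ (resp. $\mathsf{SBC}$) proof is like a resolution proof but additionally allows adding a clause that is a RAT (resp. SBC) w.r.t. the current $\Gamma_i$; the $^-$ versions require every variable in the proof to lie in $\mathrm{var}(\Gamma)$. Size is the number $N$ of formulas in the sequence. Extended resolution ($\mathsf{ER}$): for a formula $\Delta$, literals $p,q$ and a variable $x$ not occurring in $\Delta,p,q$, $\{\bar x\vee p,\ \bar x\vee q,\ x\vee\bar p\vee\bar q\}$ is a set of extension clauses for $\Delta$. $\Lambda$ is an extension for $\Gamma$ if $\Lambda=\bigcup_{i=1}^t\lambda_i$ with each $\lambda_i$ a set of extension clauses for $\Gamma\cup\lambda_1\cup\dots\cup\lambda_{i-1}$. An $\mathsf{ER}$ proof of $\Gamma$ is a pair $(\Lambda,\Pi)$ with $\Lambda$ an extension for $\Gamma$ and $\Pi$ a resolution proof of $\Gamma\cup\Lambda$; size $|\Lambda|+|\Pi|$. Construction: for unsatisfiable $\Gamma$, fix a minimum-size $\mathsf{ER}$ proof $(\Lambda,\Pi)$ of $\Gamma$, $\Lambda$ being the union of $t(\Gamma)=|\Lambda|/3$ sets $\lambda_i=\{\bar x_i\vee p_i,\ \bar x_i\vee q_i,\ x_i\vee\bar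 p_i\vee\bar q_i\}$ with extension variables $x_1,\dots,x_{t(\Gamma)}$. Define $\mathcal{G}(\Gamma)=\Gamma\cup\bigcup_{i=1}^{t(\Gamma)}\big[(x_i\vee\Gamma)\cup(\bar x_i\vee\Gamma)\big]$. Bit pigeonhole principle: for $n=2^k$, $k\ge1$, variables $p^x_\ell$ ($x\in[n+1]$, $\ell\in[k]$); writing "$v\neq0$" for $v$ and "$v\neq1$" for $\bar v$, $\mathrm{BPHP}_n$ is the set of clauses $\bigvee_{\ell=1}^k (p^x_\ell\neq h_\ell)\vee\bigvee_{\ell=1}^k(p^y_\ell\neq h_\ell)$ over all $x\ne y$ in $[n+1]$ and $h\in\{0,1\}^k$. For other $n\ge2$, $\mathrm{BPHP}_n:=\mathrm{BPHP}_m$ with $m$ the largest power of two $\le n$. *)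

theory Defs
  imports Complex_Main
begin

datatype 'v literal = Pos (atm: 'v) | Neg (atm: 'v)

type_synonym 'v clause = "'v literal set"
type_synonym 'v formula = "'v clause set"

fun neg :: "'v literal \<Rightarrow> 'v literal" where
  "neg (Pos v) = Neg v"
| "neg (Neg v) = Pos v"

definition tautological :: "'v literal set \<Rightarrow> bool" where
  "tautological S \<longleftrightarrow> (\<exists>l\<in>S. neg l \<in> S)"

definition is_clause :: "'v clause \<Rightarrow> bool" where
  "is_clause C \<longleftrightarrow> finite C \<and> \<not> tautological C"

definition is_formula :: "'v formula \<Rightarrow> bool" where
  "is_formula \<Gamma> \<longleftrightarrow> finite \<Gamma> \<and> (\<forall>C\<in>\<Gamma>. is_clause C)"

definition vars :: "'v formula \<Rightarrow> 'v set" where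
  "vars \<Gamma> = (\<Union>C\<in>\<Gamma>. atm ` C)"

fun holds :: "('v \<Rightarrow> bool) \<Rightarrow> 'v literal \<Rightarrow> bool" where
  "holds \<nu> (Pos v) \<longleftrightarrow> \<nu> v"
| "holds \<nu> (Neg v) \<longleftrightarrow> \<not> \<nu> v"

definition unsatisfiable :: "'v formula \<Rightarrow> bool" where
  "unsatisfiable \<Gamma> \<longleftrightarrow> (\<nexists>\<nu>. \<forall>C\<in>\<Gamma>. \<exists>l\<in>C. holds \<nu> l)"

definition resolvent :: "'v clause \<Rightarrow> 'v clause \<Rightarrow> 'v clause \<Rightarrow> bool" where
  "resolvent C1 C2 R \<longleftrightarrow>
     (\<exists>x C D. C1 = insert (Pos x) C \<and> C2 = insert (Neg x) D \<and>
        is_clause C1 \<and> is_clause C2 \<and>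
        Pos x \<notin> C \<union> D \<and> Neg x \<notin> C \<union> D \<and>
        \<not> tautological (C \<union> D) \<and> R = C \<union> D)"

text \<open>A rule \<open>S\<close> relates the current formula to the clauses that may be added to it in one step.\<close>

type_synonym 'v rule = "'v formula \<Rightarrow> 'v clause \<Rightarrow> bool"

definition weakening_rule :: "'v rule" where
  "weakening_rule \<Gamma> C \<longleftrightarrow> is_clause C \<and> (\<exists>D\<in>\<Gamma>. D \<subseteq> C)"

definition resolution_rule :: "'v rule" where
  "resolution_rule \<Gamma> C \<longleftrightarrow>
     (\<exists>C1\<in>\<Gamma>. \<exists>C2\<in>\<Gamma>. resolvent C1 C2 C) \<or> weakening_rule \<Gamma> C"

definition unit_rule :: "'v rule" where
  "unit_rule \<Gamma> C \<longleftrightarrow>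
     (\<exists>C1\<in>\<Gamma>. \<exists>C2\<in>\<Gamma>. resolvent C1 C2 C \<and> (card C1 = 1 \<or> card C2 = 1)) \<or>
     weakening_rule \<Gamma> C"

text \<open>A proof is the list of its successive formulas; its size is the length of the list.\<close>

definition proof_by :: "'v rule \<Rightarrow> 'v formula \<Rightarrow> 'v formula list \<Rightarrow> bool" where
  "proof_by S \<Gamma> P \<longleftrightarrow>
     P \<noteq> [] \<and> hd P = \<Gamma> \<and> {} \<in> last P \<and>
     (\<forall>i. Suc i < length P \<longrightarrow> (\<exists>C. S (P ! i) C \<and> P ! Suc i = P ! i \<union> {C}))"

definition unit_implies :: "'v formula \<Rightarrow> 'v literal set \<Rightarrow> bool" where
  "unit_implies \<Gamma> L \<longleftrightarrow> (\<exists>P. proof_by unit_rule (\<Gamma> \<union> {{neg l} |l. l \<in> L}) P)"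

definition is_RAT :: "'v formula \<Rightarrow> 'v clause \<Rightarrow> 'v literal \<Rightarrow> bool" where
  "is_RAT \<Gamma> C p \<longleftrightarrow> is_clause C \<and> p \<in> C \<and>
     (\<forall>D\<in>\<Gamma>. neg p \<in> D \<longrightarrow> unit_implies \<Gamma> ((C - {p}) \<union> (D - {neg p})))"

definition is_SBC :: "'v formula \<Rightarrow> 'v clause \<Rightarrow> 'v literal set \<Rightarrow> bool" where
  "is_SBC \<Gamma> C L \<longleftrightarrow> is_clause C \<and> L \<noteq> {} \<and> L \<subseteq> C \<and>
     (\<forall>D\<in>\<Gamma>. D \<inter> neg ` L \<noteq> {} \<and> D \<inter> L = {} \<longrightarrow>
        tautological ((C - L) \<union> (D - neg ` L)))"

definition RAT_rule :: "'v rule" where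
  "RAT_rule \<Gamma> C \<longleftrightarrow> resolution_rule \<Gamma> C \<or> (\<exists>p. is_RAT \<Gamma> C p)"

definition SBC_rule :: "'v rule" where
  "SBC_rule \<Gamma> C \<longleftrightarrow> resolution_rule \<Gamma> C \<or> (\<exists>L. is_SBC \<Gamma> C L)"

definition no_new_vars :: "'v formula \<Rightarrow> 'v formula list \<Rightarrow> bool" where
  "no_new_vars \<Gamma> P \<longleftrightarrow> (\<forall>\<Delta>\<in>set P. vars \<Delta> \<subseteq> vars \<Gamma>)"

definition RAT_minus_proof :: "'v formula \<Rightarrow> 'v formula list \<Rightarrow> bool" where
  "RAT_minus_proof \<Gamma> P \<longleftrightarrow> proof_by RAT_rule \<Gamma> P \<and> no_new_vars \<Gamma> P"

definition SBC_minus_proof :: "'v formula \<Rightarrow> 'v formula list \<Rightarrow> bool" where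
  "SBC_minus_proof \<Gamma> P \<longleftrightarrow> proof_by SBC_rule \<Gamma> P \<and> no_new_vars \<Gamma> P"

text \<open>
  An extension is given by the list of the triples \<open>(x\<^sub>i, p\<^sub>i, q\<^sub>i)\<close> rather than by the bare set of
  its clauses, so that its extension variables can be read off.
\<close>

type_synonym 'v extension = "('v \<times> 'v literal \<times> 'v literal) list"

definition ext_clauses :: "'v \<times> 'v literal \<times> 'v literal \<Rightarrow> 'v formula" where
  "ext_clauses = (\<lambda>(x, p, q). {{Neg x, p}, {Neg x, q}, {Pos x, neg p, neg q}})"

definition ext_formula :: "'v extension \<Rightarrow> 'v formula" where
  "ext_formula es = (\<Union>e\<in>set es. ext_clauses e)"

definition ext_vars :: "'v extension \<Rightarrow> 'v set" where
  "ext_vars es = fst ` set es"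

text \<open>Nontautology of the three clauses excludes \<open>q = neg p\<close>.\<close>

fun is_extension :: "'v formula \<Rightarrow> 'v extension \<Rightarrow> bool" where
  "is_extension \<Gamma> [] \<longleftrightarrow> True"
| "is_extension \<Gamma> ((x, p, q) # es) \<longleftrightarrow>
     x \<notin> vars \<Gamma> \<and> x \<noteq> atm p \<and> x \<noteq> atm q \<and>
     is_formula (ext_clauses (x, p, q)) \<and>
     is_extension (\<Gamma> \<union> ext_clauses (x, p, q)) es"

definition ER_proof :: "'v formula \<Rightarrow> 'v extension \<times> 'v formula list \<Rightarrow> bool" where
  "ER_proof \<Gamma> = (\<lambda>(es, P).
     is_extension \<Gamma> es \<and> proof_by resolution_rule (\<Gamma> \<union> ext_formula es) P)"

definition ER_size :: "'v extension \<times> 'v formula list \<Rightarrow> nat" where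
  "ER_size = (\<lambda>(es, P). card (ext_formula es) + length P)"

definition min_ER_proof :: "'v formula \<Rightarrow> 'v extension \<times> 'v formula list \<Rightarrow> bool" where
  "min_ER_proof \<Gamma> = is_arg_min ER_size (ER_proof \<Gamma>)"

definition min_ER_choice ::
    "('v formula \<Rightarrow> 'v extension \<times> 'v formula list) \<Rightarrow> bool" where
  "min_ER_choice E \<longleftrightarrow>
     (\<forall>\<Gamma>. is_formula \<Gamma> \<and> unsatisfiable \<Gamma> \<longrightarrow> min_ER_proof \<Gamma> (E \<Gamma>))"

definition clause_or :: "'v clause \<Rightarrow> 'v formula \<Rightarrow> 'v formula" where
  "clause_or C \<Delta> = {C \<union> D |D. D \<in> \<Delta> \<and> \<not> tautological (C \<union> D)}"

definition guarded ::
    "('v formula \<Rightarrow> 'v extension \<times> 'v formula list) \<Rightarrow> 'v formula \<Rightarrow> 'v formula" where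
  "guarded E \<Gamma> =
     \<Gamma> \<union> (\<Union>x\<in>ext_vars (fst (E \<Gamma>)). clause_or {Pos x} \<Gamma> \<union> clause_or {Neg x} \<Gamma>)"

text \<open>
  The variable \<open>(x, l)\<close> is the \<open>l\<close>-th bit of the hole of pigeon \<open>x\<close>, with \<open>True\<close> for the bit 1.
  Pairs out of range do not occur in the formula and serve as a supply of fresh variables.
\<close>

definition lit_neq :: "'v \<Rightarrow> bool \<Rightarrow> 'v literal" where
  "lit_neq v b = (if b then Neg v else Pos v)"

definition BPHP_pow :: "nat \<Rightarrow> (nat \<times> nat) formula" where
  "BPHP_pow k =
     {(\<lambda>l. lit_neq (x, l) (h l)) ` {1..k} \<union> (\<lambda>l. lit_neq (y, l) (h l)) ` {1..k} |x y h.
        x \<in> {1..2 ^ k + 1} \<and> y \<in> {1..2 ^ k + 1} \<and> x \<noteq> y}"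

definition BPHP :: "nat \<Rightarrow> (nat \<times> nat) formula" where
  "BPHP n = BPHP_pow (GREATEST k. 2 ^ k \<le> n)"

end

theory Submission
  imports Defs
begin

text \<open>
  RAT proofs: the guards \<open>x \<or> \<Gamma>\<close> and \<open>\<not>x \<or> \<Gamma>\<close> are subsumed by \<open>\<Gamma>\<close>, so a definition of \<open>x\<close> is RAT
  on \<open>x\<close>, and a minimum-size ER proof can be replayed. ER refutes the bit pigeonhole principle in
  polynomial size by Cook's reduction from \<open>m + 1\<close> pigeons to \<open>m\<close>, carried out on the bits: each step
  is a semantic consequence involving \<open>O(log n)\<close> variables, and there are only polynomially many
  clauses over so few variables.

  SBC proofs: a clause that is set-blocked for a set containing an extension variable \<open>x\<close> would yield
  an assignment satisfying \<open>\<Gamma>\<close>, because the guards of \<open>x\<close> must be satisfied through \<open>\<Gamma>\<close>. A clause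
  set-blocked on a bit of a pigeon must mention every other pigeon. A short proof has few
  clauses mentioning many pigeons, and a small partial matching, chosen greedily, satisfies
  them all. Under this matching the proof is a resolution proof in which all clauses mention few
  pigeons, and no small extension of the matching ever falsifies a clause of such a proof.
\<close>

section \<open>Literals and sequences of proof steps\<close>

text \<open>Set-blockedness need not survive a restriction, so the SBC proof is never actually
  restricted. Its clauses are shown to satisfy one invariant instead: no matching of at most
  \<open>3 * q\<close> pigeons extending the chosen one falsifies them, where
  \<open>2 ^ k = 4 * q\<close>. The chosen matching has \<open>q\<close> pigeons, and a clause is
  wide if it mentions at least \<open>2 * q\<close>; a set-blocked clause mentions all
  \<open>4 * q + 1\<close>, so it is wide and needs no further analysis. For the upper bound no
  resolution derivation is written out. Closing a formula under resolution among the clauses over a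
  few variables takes at most as many steps as there are such clauses, and completeness reduces the
  presence of each wanted clause to a semantic check. These are collapsed to a single variable, so
  renaming has to cope with clauses that become tautological.\<close>

lemma neg_neg [simp]: "neg (neg l) = l"
  by (cases l) auto

lemma atm_neg [simp]: "atm (neg l) = atm l"
  by (cases l) auto

lemma neg_neq [simp]: "neg l \<noteq> l" "l \<noteq> neg l"
  by (cases l; auto)+

lemma holds_neg [simp]: "holds \<nu> (neg l) \<longleftrightarrow> \<not> holds \<nu> l"
  by (cases l) auto

lemma neg_map_literal [simp]: "neg (map_literal s l) = map_literal s (neg l)"
  by (cases l) auto

lemma atm_map_literal [simp]: "atm (map_literal s l) = s (atm l)"
  by (cases l) auto

lemma tautological_mono: "tautological S \<Longrightarrow> S \<subseteq> T \<Longrightarrow> tautological T"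
  unfolding tautological_def by blast

lemma tautological_insert: "tautological (insert l S) \<longleftrightarrow> neg l \<in> S \<or> tautological S"
proof -
  have "neg l' = l \<longleftrightarrow> l' = neg l" for l' by auto
  then show ?thesis unfolding tautological_def by auto
qed

lemma not_tautological_empty [simp]: "\<not> tautological {}"
  unfolding tautological_def by simp

lemma is_clause_subset: "is_clause C \<Longrightarrow> D \<subseteq> C \<Longrightarrow> is_clause D"
  unfolding is_clause_def using finite_subset tautological_mono by blast

lemma is_clause_neg: "is_clause C \<Longrightarrow> l \<in> C \<Longrightarrow> neg l \<notin> C"
  unfolding is_clause_def tautological_def by blast

lemma resolution_rule_clause: "resolution_rule F C \<Longrightarrow> is_clause C"
  unfolding resolution_rule_def weakening_rule_def resolvent_def is_clause_def by auto

text \<open>\<open>resolvent\<close> wants the positive literal in its first premise, so the sign of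
  \<open>l\<close> decides which order applies.\<close>

lemma resolventI:
  assumes "is_clause (insert l C)" "is_clause (insert (neg l) D)" "is_clause (C \<union> D)"
    and "l \<notin> C" "neg l \<notin> D"
  shows "resolvent (insert l C) (insert (neg l) D) (C \<union> D) \<or>
    resolvent (insert (neg l) D) (insert l C) (C \<union> D)"
proof -
  have "l \<notin> D" "neg l \<notin> C"
    using assms(1,2) is_clause_neg[of _ l] is_clause_neg[of _ "neg l"] by force+
  then show ?thesis
    using assms unfolding resolvent_def is_clause_def
    by (cases l) (simp, blast, simp, metis Un_commute Un_iff)
qed

text \<open>Counting steps instead of listing formulas lets proofs compose by adding lengths; a list
  of \<open>Suc n\<close> formulas is \<open>n\<close> steps.\<close>

inductive reach :: "'v rule \<Rightarrow> nat \<Rightarrow> 'v formula \<Rightarrow> 'v formula \<Rightarrow> bool" for S where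
  refl: "reach S 0 F F"
| step: "S F C \<Longrightarrow> reach S n (insert C F) F' \<Longrightarrow> reach S (Suc n) F F'"

lemma reach_trans: "reach S m F F' \<Longrightarrow> reach S n F' F'' \<Longrightarrow> reach S (m + n) F F''"
  by (induction rule: reach.induct) (auto intro: reach.step)

lemma reach_mono: "reach S n F F' \<Longrightarrow> (\<And>F C. S F C \<Longrightarrow> T F C) \<Longrightarrow> reach T n F F'"
  by (induction rule: reach.induct) (auto intro: reach.intros)

lemma reach_one: "S F C \<Longrightarrow> reach S 1 F (insert C F)"
  using reach.step[OF _ reach.refl] by simp

lemma reach_subset: "reach S n F F' \<Longrightarrow> F \<subseteq> F'"
  by (induction rule: reach.induct) auto

lemma reach_card: "reach S n F F' \<Longrightarrow> finite (F' - F) \<and> card (F' - F) \<le> n"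
proof (induction rule: reach.induct)
  case (step F C n F')
  have sub: "F' - F \<subseteq> insert C (F' - insert C F)" by auto
  have "card (F' - F) \<le> card (insert C (F' - insert C F))"
    using step.IH sub by (intro card_mono) auto
  also have "\<dots> \<le> Suc (card (F' - insert C F))" by (rule card_insert_le_m1) auto
  finally have "card (F' - F) \<le> Suc n" using step.IH by linarith
  moreover have "finite (F' - F)" using step.IH sub finite_subset by blast
  ultimately show ?case by blast
qed auto

text \<open>The step case may use \<open>F \<subseteq> F0\<close> and \<open>C \<in> F'\<close>:
  blockedness is exploited through clauses of the initial formula, while the split into wide and
  narrow clauses refers to the final one.\<close>

lemma reach_invariant:
  assumes "reach S n F F'" and "\<And>C. C \<in> F \<Longrightarrow> Q C"
    and "\<And>F0 C. F \<subseteq> F0 \<Longrightarrow> \<forall>D\<in>F0. Q D \<Longrightarrow> S F0 C \<Longrightarrow> C \<in> F' \<Longrightarrow> Q C"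
  shows "\<forall>C\<in>F'. Q C"
  using assms
proof (induction rule: reach.induct)
  case (step F C n F')
  have "C \<in> F'" using reach_subset[OF step.hyps(2)] by auto
  then have "Q C" using step.prems step.hyps by blast
  then show ?case using step.prems by (intro step.IH) auto
qed auto

lemma proof_by_Nil [simp]: "\<not> proof_by S \<Gamma> []"
  unfolding proof_by_def by simp

lemma proof_by_single [simp]: "proof_by S \<Gamma> [\<Delta>] \<longleftrightarrow> \<Delta> = \<Gamma> \<and> {} \<in> \<Gamma>"
  unfolding proof_by_def by auto

lemma proof_by_Cons [simp]:
  "proof_by S \<Gamma> (\<Delta> # \<Delta>' # P) \<longleftrightarrow>
    \<Delta> = \<Gamma> \<and> (\<exists>C. S \<Gamma> C \<and> \<Delta>' = insert C \<Gamma>) \<and> proof_by S \<Delta>' (\<Delta>' # P)"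
proof -
  have *: "(\<forall>i. Suc i < Suc (Suc n) \<longrightarrow> Q i) \<longleftrightarrow> Q 0 \<and> (\<forall>i. Suc i < Suc n \<longrightarrow> Q (Suc i))"
    for n and Q :: "nat \<Rightarrow> bool"
    by (metis Suc_less_eq not0_implies_Suc zero_less_Suc)
  show ?thesis unfolding proof_by_def using *[of "length P"] by auto
qed

lemma reach_imp_proof_by:
  "reach S n F F' \<Longrightarrow> {} \<in> F' \<Longrightarrow> \<exists>P. proof_by S F P \<and> length P = Suc n"
proof (induction rule: reach.induct)
  case (refl F)
  then show ?case by (intro exI[of _ "[F]"]) auto
next
  case (step F C n F')
  then obtain P where P: "proof_by S (insert C F) P" "length P = Suc n" by auto
  then obtain P' where "P = insert C F # P'"
    unfolding proof_by_def by (cases P) auto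
  with P step.hyps show ?case by (intro exI[of _ "F # P"]) auto
qed

lemma proof_by_imp_reach:
  "proof_by S F P \<Longrightarrow> reach S (length P - 1) F (last P)"
proof (induction P arbitrary: F)
  case (Cons \<Delta> P)
  show ?case
  proof (cases P)
    case Nil
    then show ?thesis using Cons.prems by (auto intro: reach.refl)
  next
    case (Cons \<Delta>' P')
    with Cons.prems obtain C where "S F C" "proof_by S (insert C F) P" by auto
    with Cons.IH show ?thesis using Cons by (auto intro: reach.step)
  qed
qed auto

lemma last_proof_by: "proof_by S F P \<Longrightarrow> {} \<in> last P"
  unfolding proof_by_def by auto

text \<open>A side condition on single steps, so that the ban on new variables passes through
  composition and renaming of proofs.\<close>

definition over_vars :: "'v set \<Rightarrow> 'v rule \<Rightarrow> 'v rule" where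
  "over_vars W S F C \<longleftrightarrow> S F C \<and> atm ` C \<subseteq> W"

lemma vars_insert [simp]: "vars (insert C F) = atm ` C \<union> vars F"
  unfolding vars_def by auto

lemma vars_Un [simp]: "vars (F \<union> G) = vars F \<union> vars G"
  unfolding vars_def by auto

lemma proof_within:
  assumes "proof_by (over_vars W S) F P" "vars F \<subseteq> W"
  shows "proof_by S F P \<and> (\<forall>\<Delta>\<in>set P. vars \<Delta> \<subseteq> W)"
  using assms
proof (induction P arbitrary: F)
  case (Cons \<Delta> P)
  show ?case
  proof (cases P)
    case Nil
    then show ?thesis using Cons.prems by auto
  next
    case (Cons \<Delta>' P')
    with Cons.prems obtain C where C: "over_vars W S F C" "\<Delta>' = insert C F"
      "proof_by (over_vars W S) (insert C F) P" by auto
    then have "vars (insert C F) \<subseteq> W" using Cons.prems(2) by (auto simp: over_vars_def)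
    from Cons.IH[OF C(3) this] C show ?thesis
      using Cons Cons.prems by (auto simp: over_vars_def)
  qed
qed auto

section \<open>Simulating extended resolution by RAT without new variables\<close>

lemma unit_refutes:
  assumes "is_clause D" "D \<in> \<Delta>" "\<And>l. l \<in> D \<Longrightarrow> {neg l} \<in> \<Delta>"
  shows "\<exists>n F. reach unit_rule n \<Delta> F \<and> {} \<in> F"
proof -
  have "finite D" using assms(1) by (simp add: is_clause_def)
  then show ?thesis using assms
  proof (induction D arbitrary: \<Delta> rule: finite_induct)
    case empty
    then show ?case using reach.refl by blast
  next
    case (insert l D)
    have D: "is_clause D" using insert.prems(1) is_clause_subset by blast
    have "is_clause {neg l}" by (simp add: is_clause_def tautological_def)
    then have "resolvent (insert l D) {neg l} D \<or> resolvent {neg l} (insert l D) D"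
      using resolventI[of l D "{}"] insert D by simp
    moreover have "insert l D \<in> \<Delta>" "{neg l} \<in> \<Delta>" using insert.prems by auto
    ultimately have "unit_rule \<Delta> D" unfolding unit_rule_def by (metis One_nat_def card_1_singleton_iff)
    moreover obtain n F where "reach unit_rule n (insert D \<Delta>) F" "{} \<in> F"
      using insert.IH[of "insert D \<Delta>"] D insert.prems by auto
    ultimately show ?case using reach.step by blast
  qed
qed

lemma unit_implies_superset:
  assumes "D \<in> \<Gamma>" "is_clause D" "D \<subseteq> L"
  shows "unit_implies \<Gamma> L"
proof -
  obtain n F where "reach unit_rule n (\<Gamma> \<union> {{neg l} |l. l \<in> L}) F" "{} \<in> F"
    using unit_refutes[of D "\<Gamma> \<union> {{neg l} |l. l \<in> L}"] assms by blast
  then show ?thesis unfolding unit_implies_def using reach_imp_proof_by by blast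
qed

lemma unit_implies_tautological:
  assumes "l \<in> L" "neg l \<in> L"
  shows "unit_implies \<Gamma> L"
proof -
  have "is_clause {neg l}" by (simp add: is_clause_def tautological_def)
  moreover have "{neg l} \<in> \<Gamma> \<union> {{neg l} |l. l \<in> L}" using assms by blast
  moreover have "{neg (neg l)} \<in> \<Gamma> \<union> {{neg l} |l. l \<in> L}" using assms by blast
  ultimately obtain n F where "reach unit_rule n (\<Gamma> \<union> {{neg l} |l. l \<in> L}) F" "{} \<in> F"
    using unit_refutes[of "{neg l}" "\<Gamma> \<union> {{neg l} |l. l \<in> L}"] by auto
  then show ?thesis unfolding unit_implies_def using reach_imp_proof_by by blast
qed

text \<open>\<open>s\<close> need not be injective. If the renamed pivot or its complement reappears
  in the renamed conclusion, one premise becomes a subclause of it and weakening takes over;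
  otherwise the step remains a resolution.\<close>

lemma rename_resolution_rule:
  assumes rule: "resolution_rule F C"
    and img: "\<And>D. D \<in> F \<Longrightarrow> \<not> tautological (map_literal s ` D) \<Longrightarrow> map_literal s ` D \<in> H"
    and nt: "\<not> tautological (map_literal s ` C)"
  shows "resolution_rule H (map_literal s ` C)"
proof -
  let ?s = "\<lambda>D. map_literal s ` D"
  have fin: "finite C" using resolution_rule_clause[OF rule] by (simp add: is_clause_def)
  then have cl: "is_clause (?s C)" using nt by (simp add: is_clause_def)
  have weak: ?thesis if "D \<in> F" "?s D \<subseteq> ?s C" for D
  proof -
    have "?s D \<in> H" using img[OF that(1)] nt tautological_mono that(2) by blast
    then show ?thesis using cl that unfolding resolution_rule_def weakening_rule_def by blast
  qed
  from rule consider
    (res) C1 C2 where "C1 \<in> F" "C2 \<in> F" "resolvent C1 C2 C" | (weak) D where "D \<in> F" "D \<subseteq> C"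
    unfolding resolution_rule_def weakening_rule_def by blast
  then show ?thesis
  proof cases
    case res
    then obtain x A B where AB: "insert (Pos x) A \<in> F" "insert (Neg x) B \<in> F" "C = A \<union> B"
      unfolding resolvent_def by auto
    let ?x = "map_literal s (Pos x)"
    have nx: "neg ?x = map_literal s (Neg x)" by simp
    have ntA: "\<not> tautological (?s A)" and ntB: "\<not> tautological (?s B)"
      using nt AB(3) tautological_mono[of "?s A" "?s C"] tautological_mono[of "?s B" "?s C"] by auto
    show ?thesis
    proof (cases "?x \<in> ?s C \<or> neg ?x \<in> ?s C")
      case True
      then show ?thesis
      proof
        assume "?x \<in> ?s C"
        then show ?thesis using weak[OF AB(1)] AB(3) by auto
      next
        assume "neg ?x \<in> ?s C"
        then show ?thesis using weak[OF AB(2)] AB(3) by (auto simp: nx)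
      qed
    next
      case False
      let ?A = "insert ?x (?s A)" and ?B = "insert (neg ?x) (?s B)"
      have taut: "\<not> tautological ?A" "\<not> tautological ?B"
        using False[unfolded AB(3)] ntA ntB
        unfolding tautological_insert image_Un by (simp_all del: literal.map neg_map_literal)
      then have "?A \<in> H" "?B \<in> H"
        using img[OF AB(1)] img[OF AB(2)] by auto
      moreover have "is_clause ?A" "is_clause ?B"
        using taut fin AB(3) by (auto simp: is_clause_def)
      moreover have "?s C = ?s A \<union> ?s B" using AB(3) by auto
      ultimately show ?thesis using resolventI[of ?x "?s A" "?s B"] False cl
        unfolding resolution_rule_def by (metis UnI1 UnI2)
    qed
  next
    case weak
    then show ?thesis using \<open>\<And>D. D \<in> F \<Longrightarrow> ?s D \<subseteq> ?s C \<Longrightarrow> ?thesis\<close> by blast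
  qed
qed

text \<open>Steps whose clause becomes tautological are dropped, hence only
  \<open>m \<le> n\<close>.\<close>

lemma rename_reach:
  assumes "reach resolution_rule n F F'"
    and "\<And>C. C \<in> F \<Longrightarrow> \<not> tautological (map_literal s ` C) \<Longrightarrow> map_literal s ` C \<in> H"
    and "range s \<subseteq> W"
  shows "\<exists>m\<le>n. \<exists>H'. reach (over_vars W resolution_rule) m H H' \<and>
    (\<forall>C\<in>F'. \<not> tautological (map_literal s ` C) \<longrightarrow> map_literal s ` C \<in> H')"
  using assms(1,2)
proof (induction arbitrary: H rule: reach.induct)
  case (refl F)
  then show ?case using reach.refl by blast
next
  case (step F C n F')
  show ?case
  proof (cases "tautological (map_literal s ` C)")
    case True
    then show ?thesis using step.IH[of H] step.prems by (metis insert_iff le_SucI)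
  next
    case False
    let ?C = "map_literal s ` C"
    have "over_vars W resolution_rule H ?C"
      using rename_resolution_rule[OF step.hyps(1) step.prems False] assms(3)
      by (auto simp: over_vars_def)
    moreover obtain m H' where "m \<le> n" "reach (over_vars W resolution_rule) m (insert ?C H) H'"
      "\<forall>C\<in>F'. \<not> tautological (map_literal s ` C) \<longrightarrow> map_literal s ` C \<in> H'"
      using step.IH[of "insert ?C H"] step.prems by blast
    ultimately show ?thesis using reach.step by (metis Suc_le_mono)
  qed
qed

section \<open>Extension clauses\<close>

lemma vars_ext_clauses [simp]: "vars (ext_clauses (x, p, q)) = {x, atm p, atm q}"
  unfolding vars_def ext_clauses_def by auto

lemma is_extension_fresh: "is_extension \<Gamma> es \<Longrightarrow> x \<in> ext_vars es \<Longrightarrow> x \<notin> vars \<Gamma>"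
  by (induction \<Gamma> es rule: is_extension.induct) (auto simp: ext_vars_def)

lemma ext_formula_Cons [simp]: "ext_formula (e # es) = ext_clauses e \<union> ext_formula es"
  by (simp add: ext_formula_def)

lemma finite_ext_clauses [simp]: "finite (ext_clauses e)"
  by (cases e) (simp add: ext_clauses_def)

lemma finite_ext_formula [simp]: "finite (ext_formula es)"
  by (simp add: ext_formula_def)

text \<open>Definitions with \<open>p = q\<close> have only two clauses, so just one new clause per
  definition is counted. \<open>{Neg x, p}\<close> is new because every later definition puts its
  own variable into all its clauses, and that variable is neither \<open>x\<close> nor
  \<open>atm p\<close>.\<close>

lemma length_le_card_ext_formula:
  "is_extension \<Gamma> es \<Longrightarrow> length es \<le> card (ext_formula es)"
proof (induction \<Gamma> es rule: is_extension.induct)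
  case (2 \<Gamma> x p q es)
  have "{Neg x, p} \<notin> ext_formula es"
  proof
    assume "{Neg x, p} \<in> ext_formula es"
    then obtain x' p' q' where "(x', p', q') \<in> set es" "{Neg x, p} \<in> ext_clauses (x', p', q')"
      unfolding ext_formula_def by auto
    moreover have "x' \<in> atm ` C" if "C \<in> ext_clauses (x', p', q')" for C
      using that by (auto simp: ext_clauses_def)
    ultimately have "x' \<in> atm ` {Neg x, p}" by blast
    then have "x' \<in> {x, atm p}" by simp
    have "x' \<in> ext_vars es"
      using \<open>(x', p', q') \<in> set es\<close> unfolding ext_vars_def by (metis fst_conv imageI)
    moreover have "x' \<notin> vars (\<Gamma> \<union> ext_clauses (x, p, q))"
      by (rule is_extension_fresh[of _ es]) (use "2.prems" \<open>x' \<in> ext_vars es\<close> in auto)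
    ultimately show False using \<open>x' \<in> {x, atm p}\<close> by auto
  qed
  then have "Suc (card (ext_formula es)) = card (insert {Neg x, p} (ext_formula es))"
    by simp
  also have "\<dots> \<le> card (ext_formula ((x, p, q) # es))"
    by (rule card_mono) (simp_all add: ext_clauses_def insertI1 subset_insertI2)
  finally show ?case using "2.IH" "2.prems" by auto
qed simp

text \<open>Besides the guards \<open>D'\<close>, only extension clauses mention the extension variable,
  and those clash with the new clause on \<open>p\<close> or \<open>q\<close>.\<close>

lemma is_RAT_guard:
  assumes "is_clause C" "l \<in> C" "\<Gamma> \<subseteq> H" "is_formula \<Gamma>" "atm l \<notin> vars \<Gamma>"
    and "\<And>D. D \<in> H \<Longrightarrow> neg l \<in> D \<Longrightarrow>
      (\<exists>D'\<in>\<Gamma>. D = insert (neg l) D') \<or> (\<exists>q. neg q \<in> C - {l} \<and> q \<in> D - {neg l})"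
  shows "is_RAT H C l"
  unfolding is_RAT_def
proof (intro conjI ballI impI)
  fix D assume D: "D \<in> H" "neg l \<in> D"
  from assms(6)[OF D] show "unit_implies H (C - {l} \<union> (D - {neg l}))"
  proof
    assume "\<exists>D'\<in>\<Gamma>. D = insert (neg l) D'"
    then obtain D' where D': "D' \<in> \<Gamma>" "D = insert (neg l) D'" by blast
    have "neg l \<notin> D'"
    proof
      assume "neg l \<in> D'"
      then have "atm (neg l) \<in> vars \<Gamma>" using D'(1) unfolding vars_def by blast
      then show False using assms(5) by simp
    qed
    then have "D' \<subseteq> C - {l} \<union> (D - {neg l})" using D'(2) by auto
    moreover have "D' \<in> H" "is_clause D'" using D'(1) assms(3,4) by (auto simp: is_formula_def)
    ultimately show ?thesis by (intro unit_implies_superset[of D'])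
  next
    assume "\<exists>q. neg q \<in> C - {l} \<and> q \<in> D - {neg l}"
    then obtain q where "neg q \<in> C - {l}" "q \<in> D - {neg l}" by blast
    then show ?thesis by (intro unit_implies_tautological[of q]) simp_all
  qed
qed (use assms(1,2) in auto)

text \<open>The last premise says that a variable still to be defined occurs in guards only. It
  survives the three additions because \<open>s\<close> sends nothing else to an extension variable.
  The two clauses with \<open>Neg x\<close> come first: while they are added, \<open>Pos x\<close>
  occurs in guards only.\<close>

lemma extension_reach:
  assumes "is_extension \<Gamma>' es" "\<Gamma> \<subseteq> \<Gamma>'" "\<Gamma> \<subseteq> H" "is_formula \<Gamma>" "range s \<subseteq> W"
    and "\<And>x v. x \<in> ext_vars es \<Longrightarrow> s v = x \<longleftrightarrow> v = x"
    and "\<And>x D. x \<in> ext_vars es \<Longrightarrow> D \<in> H \<Longrightarrow> x \<in> atm ` D \<Longrightarrow>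
      \<exists>D'\<in>\<Gamma>. D = insert (Pos x) D' \<or> D = insert (Neg x) D'"
  shows "\<exists>m\<le>3 * length es. \<exists>H'. reach (over_vars W RAT_rule) m H H' \<and>
    (\<forall>C\<in>ext_formula es. \<not> tautological (map_literal s ` C) \<longrightarrow> map_literal s ` C \<in> H')"
  using assms(1-3,6,7)
proof (induction \<Gamma>' es arbitrary: H rule: is_extension.induct)
  case (1 \<Gamma>')
  then show ?case using reach.refl by (fastforce simp: ext_formula_def)
next
  case (2 \<Gamma>' x p q es)
  let ?s = "map_literal s" and ?S = "over_vars W RAT_rule"
  have xv: "x \<in> ext_vars ((x, p, q) # es)" and xsub: "ext_vars es \<subseteq> ext_vars ((x, p, q) # es)"
    by (auto simp: ext_vars_def)
  have ext: "is_extension (\<Gamma>' \<union> ext_clauses (x, p, q)) es" and "x \<notin> vars \<Gamma>'"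
    and pq: "x \<noteq> atm p" "x \<noteq> atm q" using "2.prems"(1) by auto
  then have x\<Gamma>: "x \<notin> vars \<Gamma>" using \<open>\<Gamma> \<subseteq> \<Gamma>'\<close> by (auto simp: vars_def)
  have sx: "s x = x" using "2.prems"(4)[OF xv] by simp
  have spq: "s (atm p) \<noteq> x" "s (atm q) \<noteq> x" using "2.prems"(4)[OF xv] pq by auto
  have guards: "\<exists>D'\<in>\<Gamma>. D = insert (Pos x) D' \<or> D = insert (Neg x) D'" if "D \<in> H" "x \<in> atm ` D" for D
    using "2.prems"(5)[OF xv] that by blast
  have guard: "\<exists>D'\<in>\<Gamma>. D = insert l D'" if "D \<in> H" "l \<in> D" "atm l = x" for D l
  proof -
    have "x \<in> atm ` D" using that(2,3) by blast
    from guards[OF that(1) this]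
    obtain D' where D': "D' \<in> \<Gamma>" "D = insert (Pos x) D' \<or> D = insert (Neg x) D'" by blast
    moreover have "l \<notin> D'" using x\<Gamma> D'(1) that(3) by (auto simp: vars_def)
    ultimately show ?thesis using that(2) by auto
  qed
  define C1 C2 C3 where C: "C1 = {Neg x, ?s p}" "C2 = {Neg x, ?s q}"
    "C3 = {Pos x, neg (?s p), neg (?s q)}"
  have inW: "x \<in> W" "s (atm p) \<in> W" "s (atm q) \<in> W" using assms(5) sx by (metis range_subsetD)+
  have ne: "?s p \<noteq> Pos x" "?s q \<noteq> Pos x" "?s p \<noteq> Neg x" "?s q \<noteq> Neg x"
    using spq by (metis atm_map_literal literal.sel)+
  have cl: "is_clause C1" "is_clause C2"
    unfolding C is_clause_def tautological_insert using ne by simp_all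
  have RAT1: "is_RAT H C1 (Neg x)"
  proof (rule is_RAT_guard[OF cl(1) _ "2.prems"(3) assms(4)])
    fix D assume "D \<in> H" "neg (Neg x) \<in> D"
    then show "(\<exists>D'\<in>\<Gamma>. D = insert (neg (Neg x)) D') \<or>
      (\<exists>q. neg q \<in> C1 - {Neg x} \<and> q \<in> D - {neg (Neg x)})"
      using guard[of D "Pos x"] by simp
  qed (use x\<Gamma> in \<open>simp_all add: C\<close>)
  have RAT2: "is_RAT (insert C1 H) C2 (Neg x)"
  proof (rule is_RAT_guard[OF cl(2) _ _ assms(4)])
    fix D assume "D \<in> insert C1 H" "neg (Neg x) \<in> D"
    then have "D \<in> H" "Pos x \<in> D" using ne by (auto simp: C)
    then show "(\<exists>D'\<in>\<Gamma>. D = insert (neg (Neg x)) D') \<or>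
      (\<exists>q. neg q \<in> C2 - {Neg x} \<and> q \<in> D - {neg (Neg x)})"
      using guard[of D "Pos x"] by simp
  qed (use "2.prems"(3) x\<Gamma> in \<open>auto simp: C\<close>)
  have RAT3: "is_RAT (insert C2 (insert C1 H)) C3 (Pos x)" if "\<not> tautological C3"
  proof (rule is_RAT_guard[OF _ _ _ assms(4)])
    fix D assume D: "D \<in> insert C2 (insert C1 H)" "neg (Pos x) \<in> D"
    have "neg (?s p) \<in> C3 - {Pos x}" "neg (?s q) \<in> C3 - {Pos x}"
      using ne neg_neg[of "?s p"] neg_neg[of "?s q"] by (auto simp: C simp del: neg_map_literal neg_neg)
    moreover have "?s p \<in> C1 - {Neg x}" "?s q \<in> C2 - {Neg x}" using ne by (auto simp: C)
    ultimately show "(\<exists>D'\<in>\<Gamma>. D = insert (neg (Pos x)) D') \<or>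
      (\<exists>q. neg q \<in> C3 - {Pos x} \<and> q \<in> D - {neg (Pos x)})"
      using guard[of D "Neg x"] D unfolding insert_iff by (metis literal.sel(2) neg.simps(1))
  qed (use "2.prems"(3) x\<Gamma> that in \<open>auto simp: C is_clause_def\<close>)
  define H1 where "H1 = insert C2 (insert C1 H)"
  \<comment> \<open>Renaming may make \<open>p\<close> and \<open>q\<close> complementary; the third
    clause is then left out.\<close>
  define H2 where "H2 = (if tautological C3 then H1 else insert C3 H1)"
  have r1: "reach ?S (1 + 1) H H1" unfolding H1_def
    using RAT1 RAT2 inW
    by (intro reach_trans[OF reach_one[of ?S H C1] reach_one])
      (auto simp: over_vars_def RAT_rule_def C)
  have "\<exists>m\<le>3. reach ?S m H H2"
  proof (cases "tautological C3")
    case True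
    then show ?thesis using r1 by (intro exI[of _ "1 + 1"]) (auto simp: H2_def)
  next
    case False
    then have "?S H1 C3" using RAT3 inW by (auto simp: H1_def over_vars_def RAT_rule_def C)
    from reach_one[of ?S, OF this] False have "reach ?S 1 H1 H2" by (simp add: H2_def)
    from reach_trans[OF r1 this] show ?thesis by (intro exI[of _ "1 + 1 + 1"]) auto
  qed
  then obtain m where m: "m \<le> 3" "reach ?S m H H2" by blast
  have "\<exists>m\<le>3 * length es. \<exists>H'. reach ?S m H2 H' \<and>
    (\<forall>C\<in>ext_formula es. \<not> tautological (?s ` C) \<longrightarrow> ?s ` C \<in> H')"
  proof (rule "2.IH"[OF ext])
    show "\<Gamma> \<subseteq> \<Gamma>' \<union> ext_clauses (x, p, q)" "\<Gamma> \<subseteq> H2" using "2.prems" by (auto simp: H2_def H1_def)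
    show "s v = y \<longleftrightarrow> v = y" if "y \<in> ext_vars es" for y v using "2.prems"(4) xsub that by blast
    fix y D assume y: "y \<in> ext_vars es" "D \<in> H2" "y \<in> atm ` D"
    have ne: "y \<noteq> x" "y \<noteq> atm p" "y \<noteq> atm q" using is_extension_fresh[OF ext y(1)] by auto
    have yv: "y \<in> ext_vars ((x, p, q) # es)" using xsub y(1) by blast
    have "y \<noteq> s (atm p)" "y \<noteq> s (atm q)"
      using "2.prems"(4)[OF yv, of "atm p"] "2.prems"(4)[OF yv, of "atm q"] ne by auto
    with ne have "y \<notin> atm ` C1" "y \<notin> atm ` C2" "y \<notin> atm ` C3" by (auto simp: C)
    then have "D \<in> H" using y(2,3) by (auto simp: H2_def H1_def split: if_splits)
    then show "\<exists>D'\<in>\<Gamma>. D = insert (Pos y) D' \<or> D = insert (Neg y) D'"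
      using "2.prems"(5)[OF yv _ y(3)] by blast
  qed
  then obtain m' H' where m': "m' \<le> 3 * length es" "reach ?S m' H2 H'"
    "\<forall>C\<in>ext_formula es. \<not> tautological (?s ` C) \<longrightarrow> ?s ` C \<in> H'" by blast
  have "H2 \<subseteq> H'" using reach_subset m' by blast
  have "?s ` C \<in> H'" if "C \<in> ext_formula ((x, p, q) # es)" "\<not> tautological (?s ` C)" for C
  proof (cases "C \<in> ext_formula es")
    case True
    then show ?thesis using m'(3) that(2) by blast
  next
    case False
    then have "C \<in> {{Neg x, p}, {Neg x, q}, {Pos x, neg p, neg q}}"
      using that(1) by (simp add: ext_clauses_def)
    then have "?s ` C = C1 \<or> ?s ` C = C2 \<or> ?s ` C = C3" using sx by (auto simp: C)
    then have "?s ` C \<in> H2" using that(2) by (auto simp: H2_def H1_def)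
    then show ?thesis using \<open>H2 \<subseteq> H'\<close> by blast
  qed
  then have "\<forall>C\<in>ext_formula ((x, p, q) # es). \<not> tautological (?s ` C) \<longrightarrow> ?s ` C \<in> H'"
    by blast
  moreover have "m + m' \<le> 3 * length ((x, p, q) # es)" using m(1) m'(1) by simp
  moreover note reach_trans[OF m(2) m'(2)]
  ultimately show ?case by meson
qed

section \<open>Guarded formulas\<close>

lemma guarded_iff:
  "C \<in> guarded E \<Gamma> \<longleftrightarrow> C \<in> \<Gamma> \<or>
    (\<exists>l D. atm l \<in> ext_vars (fst (E \<Gamma>)) \<and> D \<in> \<Gamma> \<and> C = insert l D \<and> \<not> tautological C)"
proof
  assume "C \<in> guarded E \<Gamma>"
  then consider "C \<in> \<Gamma>" | x D where "x \<in> ext_vars (fst (E \<Gamma>))" "D \<in> \<Gamma>" "\<not> tautological C"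
      "C = insert (Pos x) D \<or> C = insert (Neg x) D"
    unfolding guarded_def clause_or_def by auto
  then show "C \<in> \<Gamma> \<or>
    (\<exists>l D. atm l \<in> ext_vars (fst (E \<Gamma>)) \<and> D \<in> \<Gamma> \<and> C = insert l D \<and> \<not> tautological C)"
    by cases (blast, metis literal.sel)
next
  assume "C \<in> \<Gamma> \<or>
    (\<exists>l D. atm l \<in> ext_vars (fst (E \<Gamma>)) \<and> D \<in> \<Gamma> \<and> C = insert l D \<and> \<not> tautological C)"
  then show "C \<in> guarded E \<Gamma>"
  proof
    assume "\<exists>l D. atm l \<in> ext_vars (fst (E \<Gamma>)) \<and> D \<in> \<Gamma> \<and> C = insert l D \<and> \<not> tautological C"
    then obtain l D where "atm l \<in> ext_vars (fst (E \<Gamma>))" "D \<in> \<Gamma>" "C = insert l D" "\<not> tautological C"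
      by blast
    moreover from this have "C \<in> clause_or {Pos (atm l)} \<Gamma> \<union> clause_or {Neg (atm l)} \<Gamma>"
      unfolding clause_or_def by (cases l) auto
    ultimately show ?thesis unfolding guarded_def by blast
  qed (simp add: guarded_def)
qed

text \<open>This is what the guards give to RAT: extension variables count as old. A guard is
  nontautological because its variable does not occur in \<open>D\<close>.\<close>

lemma vars_guarded:
  assumes "is_formula \<Gamma>" "vars \<Gamma> \<noteq> {}"
    and fresh: "ext_vars (fst (E \<Gamma>)) \<inter> vars \<Gamma> = {}"
  shows "vars (guarded E \<Gamma>) = vars \<Gamma> \<union> ext_vars (fst (E \<Gamma>))"
proof
  have "atm ` C \<subseteq> vars \<Gamma> \<union> ext_vars (fst (E \<Gamma>))" if "C \<in> guarded E \<Gamma>" for C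
    using that unfolding guarded_iff vars_def by auto
  then show "vars (guarded E \<Gamma>) \<subseteq> vars \<Gamma> \<union> ext_vars (fst (E \<Gamma>))"
    unfolding vars_def[of "guarded E \<Gamma>"] by blast
next
  obtain D where D: "D \<in> \<Gamma>" using assms(2) by (auto simp: vars_def)
  have "x \<in> vars (guarded E \<Gamma>)" if "x \<in> ext_vars (fst (E \<Gamma>))" for x
  proof -
    have "x \<notin> atm ` D" using that fresh D unfolding vars_def by blast
    then have "Neg x \<notin> D" by force
    moreover have "\<not> tautological D" using D assms(1) by (auto simp: is_formula_def is_clause_def)
    ultimately have "\<not> tautological (insert (Pos x) D)" by (simp add: tautological_insert)
    then have "insert (Pos x) D \<in> guarded E \<Gamma>"
      unfolding guarded_iff using that D by (metis literal.sel(1))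
    then show ?thesis unfolding vars_def by (metis UN_I imageI insertI1 literal.sel(1))
  qed
  moreover have "vars \<Gamma> \<subseteq> vars (guarded E \<Gamma>)" unfolding vars_def guarded_def by blast
  ultimately show "vars \<Gamma> \<union> ext_vars (fst (E \<Gamma>)) \<subseteq> vars (guarded E \<Gamma>)" by blast
qed

lemma guarded_RAT_minus_proof:
  assumes ER: "ER_proof \<Gamma> (E \<Gamma>)" and \<Gamma>: "is_formula \<Gamma>" "vars \<Gamma> \<noteq> {}"
  shows "\<exists>P. RAT_minus_proof (guarded E \<Gamma>) P \<and> length P \<le> 3 * ER_size (E \<Gamma>)"
proof -
  obtain es P where E: "E \<Gamma> = (es, P)" by fastforce
  then have es: "is_extension \<Gamma> es" and P: "proof_by resolution_rule (\<Gamma> \<union> ext_formula es) P"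
    using ER by (auto simp: ER_proof_def)
  let ?G = "guarded E \<Gamma>" and ?W = "vars \<Gamma> \<union> ext_vars es"
  obtain u where u: "u \<in> vars \<Gamma>" using \<Gamma> by blast
  text \<open>Variables foreign to the guarded formula are collapsed to a variable of \<open>\<Gamma>\<close>: a minimal
    proof may use them in definitions or weakenings.\<close>
  define s where "s v = (if v \<in> ?W then v else u)" for v
  have s: "range s \<subseteq> ?W" using u by (auto simp: s_def)
  have fresh: "x \<notin> vars \<Gamma>" if "x \<in> ext_vars es" for x using is_extension_fresh[OF es that] .
  have vG: "vars ?G = ?W"
    using vars_guarded[OF \<Gamma>, of E] fresh by (auto simp: E)
  have "\<exists>m\<le>3 * length es. \<exists>H'. reach (over_vars ?W RAT_rule) m ?G H' \<and>
    (\<forall>C\<in>ext_formula es. \<not> tautological (map_literal s ` C) \<longrightarrow> map_literal s ` C \<in> H')"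
  proof (rule extension_reach[OF es order_refl _ \<Gamma>(1) s])
    show "\<Gamma> \<subseteq> ?G" by (auto simp: guarded_def)
    show "s v = x \<longleftrightarrow> v = x" if "x \<in> ext_vars es" for x v
      using fresh[OF that] that u by (auto simp: s_def)
    fix x D assume x: "x \<in> ext_vars es" "D \<in> ?G" "x \<in> atm ` D"
    have nx: "x \<notin> atm ` D'" if "D' \<in> \<Gamma>" for D' using that fresh[OF x(1)] by (auto simp: vars_def)
    obtain l D' where "D' \<in> \<Gamma>" "D = insert l D'" using x nx unfolding guarded_iff by blast
    moreover have "l = Pos x \<or> l = Neg x" using x(3) nx calculation by (cases l) auto
    ultimately show "\<exists>D'\<in>\<Gamma>. D = insert (Pos x) D' \<or> D = insert (Neg x) D'" by blast
  qed
  then obtain m H where H: "m \<le> 3 * length es" "reach (over_vars ?W RAT_rule) m ?G H"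
    "\<forall>C\<in>ext_formula es. \<not> tautological (map_literal s ` C) \<longrightarrow> map_literal s ` C \<in> H" by blast
  have idG: "map_literal s ` C = C" if "C \<in> \<Gamma>" for C
  proof -
    have "map_literal s l = l" if "l \<in> C" for l
    proof -
      have "atm l \<in> ?W" using that \<open>C \<in> \<Gamma>\<close> by (auto simp: vars_def)
      then show ?thesis by (cases l) (auto simp: s_def)
    qed
    then show ?thesis by simp
  qed
  have "\<Gamma> \<subseteq> H" using reach_subset[OF H(2)] by (auto simp: guarded_def)
  then have "map_literal s ` C \<in> H"
    if "C \<in> \<Gamma> \<union> ext_formula es" "\<not> tautological (map_literal s ` C)" for C
    using that H(3) idG by auto
  from rename_reach[OF proof_by_imp_reach[OF P] this s]
  obtain m' H' where H': "m' \<le> length P - 1" "reach (over_vars ?W resolution_rule) m' H H'"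
    "\<forall>C\<in>last P. \<not> tautological (map_literal s ` C) \<longrightarrow> map_literal s ` C \<in> H'" by blast
  have "{} \<in> H'" using H'(3) last_proof_by[OF P] by (force simp: tautological_def)
  moreover have "reach (over_vars ?W RAT_rule) (m + m') ?G H'"
    by (rule reach_trans[OF H(2) reach_mono[OF H'(2)]]) (auto simp: over_vars_def RAT_rule_def)
  ultimately obtain Q where Q: "proof_by (over_vars ?W RAT_rule) ?G Q" "length Q = Suc (m + m')"
    using reach_imp_proof_by by blast
  have "RAT_minus_proof ?G Q"
    unfolding RAT_minus_proof_def no_new_vars_def vG
    using proof_within[OF Q(1)] vG by simp
  moreover have "P \<noteq> []" using P by auto
  then have "length Q \<le> 3 * length es + length P" using Q(2) H(1) H'(1) by (cases P) auto
  then have "length Q \<le> 3 * ER_size (E \<Gamma>)"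
    using length_le_card_ext_formula[OF es] by (simp add: E ER_size_def)
  ultimately show ?thesis by blast
qed

section \<open>Saturation and local completeness of resolution\<close>

text \<open>Closure is asked for only inside \<open>U\<close>, so that the size of \<open>U\<close>
  bounds the number of steps.\<close>

definition closed_in :: "'v clause set \<Rightarrow> 'v formula \<Rightarrow> bool" where
  "closed_in U F \<longleftrightarrow> (\<forall>C\<in>U. resolution_rule F C \<longrightarrow> C \<in> F)"

lemma saturate:
  assumes "finite U"
  shows "\<exists>n\<le>card (U - F). \<exists>F'. reach resolution_rule n F F' \<and> closed_in U F'"
proof (induction "card (U - F)" arbitrary: F rule: less_induct)
  case less
  show ?case
  proof (cases "closed_in U F")
    case True
    then show ?thesis using reach.refl by blast
  next
    case False
    then obtain C where C: "C \<in> U - F" "resolution_rule F C" unfolding closed_in_def by blast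
    have "U - insert C F = (U - F) - {C}" by blast
    then have lt: "card (U - insert C F) < card (U - F)"
      using C(1) assms by (metis card_Diff1_less finite_Diff)
    from less[OF this] obtain n F' where
      "n \<le> card (U - insert C F)" "reach resolution_rule n (insert C F) F'" "closed_in U F'" by blast
    moreover from this have "reach resolution_rule (Suc n) F F'" using C(2) by (intro reach.step)
    ultimately show ?thesis using lt by (intro exI[of _ "Suc n"]) auto
  qed
qed

lemma resolution_proof_by_saturation:
  assumes "finite U" and "\<And>F'. F \<subseteq> F' \<Longrightarrow> closed_in U F' \<Longrightarrow> {} \<in> F'"
  shows "\<exists>P. proof_by resolution_rule F P \<and> length P \<le> Suc (card U)"
proof -
  obtain n F' where n: "n \<le> card (U - F)" "reach resolution_rule n F F'" "closed_in U F'"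
    using saturate[OF assms(1)] by blast
  then have "{} \<in> F'" using assms(2) reach_subset by blast
  then obtain P where "proof_by resolution_rule F P" "length P = Suc n"
    using reach_imp_proof_by n(2) by blast
  moreover have "card (U - F) \<le> card U" using assms(1) by (simp add: card_mono)
  ultimately show ?thesis using n(1) by auto
qed

abbreviation sat :: "('v \<Rightarrow> bool) \<Rightarrow> 'v clause \<Rightarrow> bool" where
  "sat \<nu> C \<equiv> \<exists>l\<in>C. holds \<nu> l"

text \<open>Induction on the variables of \<open>V\<close> missing from \<open>C\<close>. A clause
  on all of \<open>V\<close> is falsified by just one assignment to \<open>V\<close>, which also
  falsifies some \<open>D \<in> F\<close> over \<open>V\<close>, so \<open>D \<subseteq> C\<close>.
  Otherwise \<open>C\<close> is the resolvent of its two extensions by a missing variable. All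
  clauses involved are over \<open>V\<close>, hence in \<open>U\<close>.\<close>

lemma local_completeness:
  assumes closed: "closed_in U F" and V: "finite V"
    and U: "\<And>C. is_clause C \<Longrightarrow> atm ` C \<subseteq> V \<Longrightarrow> C \<in> U"
    and "is_clause C" "atm ` C \<subseteq> V"
    and "\<And>\<nu>. \<forall>D\<in>F. atm ` D \<subseteq> V \<longrightarrow> sat \<nu> D \<Longrightarrow> sat \<nu> C"
  shows "C \<in> F"
  using assms(4-)
proof (induction "card (V - atm ` C)" arbitrary: C rule: less_induct)
  case less
  have CU: "C \<in> U" using U less.prems by blast
  show ?case
  proof (cases "V \<subseteq> atm ` C")
    case True
    have "\<not> sat (\<lambda>v. Neg v \<in> C) C"
    proof
      assume "sat (\<lambda>v. Neg v \<in> C) C"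
      then obtain l where "l \<in> C" "holds (\<lambda>v. Neg v \<in> C) l" by blast
      then show False using is_clause_neg[OF less.prems(1)] by (cases l) force+
    qed
    then obtain D where D: "D \<in> F" "atm ` D \<subseteq> V" "\<not> sat (\<lambda>v. Neg v \<in> C) D"
      using less.prems(3) by blast
    have "l \<in> C" if "l \<in> D" for l
    proof -
      have "atm l \<in> atm ` C" "\<not> holds (\<lambda>v. Neg v \<in> C) l" using that D True by blast+
      then show ?thesis by (cases l) (auto, metis literal.exhaust_sel)
    qed
    then have "resolution_rule F C"
      using D(1) less.prems(1) unfolding resolution_rule_def weakening_rule_def by blast
    then show ?thesis using closed CU unfolding closed_in_def by blast
  next
    case False
    then obtain v where v: "v \<in> V" "v \<notin> atm ` C" by blast
    have "insert l C \<in> F" if "atm l = v" for l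
    proof (rule less.hyps)
      have "neg l \<notin> C" using v(2) that by (metis atm_neg imageI)
      then show "is_clause (insert l C)" using less.prems(1) by (simp add: is_clause_def tautological_insert)
      show "atm ` insert l C \<subseteq> V" using v that less.prems(2) by auto
      have "V - atm ` insert l C \<subset> V - atm ` C" using v that by auto
      then show "card (V - atm ` insert l C) < card (V - atm ` C)"
        using V by (intro psubset_card_mono) auto
      show "sat \<nu> (insert l C)" if "\<forall>D\<in>F. atm ` D \<subseteq> V \<longrightarrow> sat \<nu> D" for \<nu>
        using less.prems(3)[OF that] by blast
    qed
    then have *: "insert (Pos v) C \<in> F" "insert (Neg v) C \<in> F" by auto
    have "Pos v \<notin> C" "Neg v \<notin> C" using v(2) by force+
    then have "resolvent (insert (Pos v) C) (insert (Neg v) C) C"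
      using less.prems(1) unfolding resolvent_def
      by (intro exI[of _ v] exI[of _ C]) (auto simp: is_clause_def tautological_insert)
    then show ?thesis using * closed CU unfolding closed_in_def resolution_rule_def by blast
  qed
qed

lemma clauses_over:
  assumes "finite V"
  shows "finite {C. is_clause C \<and> atm ` C \<subseteq> V}"
    and "card {C. is_clause C \<and> atm ` C \<subseteq> V} \<le> 4 ^ card V"
proof -
  let ?L = "Pos ` V \<union> Neg ` V"
  have L: "l \<in> ?L" if "atm l \<in> V" for l using that by (cases l) auto
  have sub: "{C. is_clause C \<and> atm ` C \<subseteq> V} \<subseteq> Pow ?L"
  proof safe
    fix C l assume "atm ` C \<subseteq> V" "l \<in> C" "l \<notin> Neg ` V"
    then show "l \<in> Pos ` V" using L[of l] by blast
  qed
  then show "finite {C. is_clause C \<and> atm ` C \<subseteq> V}" using assms by (simp add: finite_subset)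
  have "card ?L \<le> card V + card V"
    using card_Un_le card_image_le[OF assms] by (meson add_mono order_trans)
  then have "card (Pow ?L) \<le> 2 ^ (card V + card V)" using assms by (simp add: card_Pow)
  also have "\<dots> = 4 ^ card V" by (simp add: power_add power_mult_distrib[symmetric])
  finally show "card {C. is_clause C \<and> atm ` C \<subseteq> V} \<le> 4 ^ card V"
    using card_mono[OF _ sub] assms by (meson finite_Pow_iff finite_UnI finite_imageI order_trans)
qed

section \<open>Polynomial-size extended resolution proofs of the bit pigeonhole principle\<close>

lemma is_formula_ext_clauses:
  assumes "x \<noteq> atm p" "x \<noteq> atm q" "q \<noteq> neg p"
  shows "is_formula (ext_clauses (x, p, q))"
proof -
  have "Neg x \<noteq> neg p" "Neg x \<noteq> neg q" using assms(1,2) by (metis atm_neg literal.sel(2))+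
  then show ?thesis
    using assms by (auto simp: is_formula_def is_clause_def ext_clauses_def tautological_insert)
qed

text \<open>Sorting by rank works even with ties: a later variable has rank at least
  \<open>r x\<close>, hence above those of \<open>atm p\<close> and \<open>atm q\<close>, and it
  differs from \<open>x\<close> by injectivity.\<close>

lemma is_extension_ranked:
  fixes r :: "'v \<Rightarrow> nat"
  assumes "finite T" "inj_on fst T"
    and T: "\<And>x p q. (x, p, q) \<in> T \<Longrightarrow>
      x \<notin> vars \<Gamma> \<and> r (atm p) < r x \<and> r (atm q) < r x \<and> q \<noteq> neg p"
  shows "\<exists>es. set es = T \<and> is_extension \<Gamma> es"
proof -
  obtain ts where ts: "set ts = T" "distinct ts" using finite_distinct_list[OF assms(1)] by blast
  define es where "es = sort_key (r \<circ> fst) ts"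
  have "set es = T" "sorted (map (r \<circ> fst) es)" "distinct (map fst es)"
    using ts assms(2) by (auto simp: es_def distinct_map)
  moreover have "is_extension \<Gamma> es"
    if "sorted (map (r \<circ> fst) es)" "distinct (map fst es)"
      "\<And>x p q. (x, p, q) \<in> set es \<Longrightarrow>
        x \<notin> vars \<Gamma> \<and> r (atm p) < r x \<and> r (atm q) < r x \<and> q \<noteq> neg p"
    for es :: "'v extension" and \<Gamma>
    using that
  proof (induction \<Gamma> es rule: is_extension.induct)
    case (2 \<Gamma> x p q es)
    have x: "x \<notin> vars \<Gamma>" "r (atm p) < r x" "r (atm q) < r x" "q \<noteq> neg p"
      using "2.prems"(3)[of x p q] by auto
    have "is_extension (\<Gamma> \<union> ext_clauses (x, p, q)) es"
    proof (rule "2.IH")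
      fix x' p' q' assume e: "(x', p', q') \<in> set es"
      then have "x' \<noteq> x" using "2.prems"(2) by force
      moreover have "r x \<le> r x'" using "2.prems"(1) e by force
      ultimately show "x' \<notin> vars (\<Gamma> \<union> ext_clauses (x, p, q)) \<and>
          r (atm p') < r x' \<and> r (atm q') < r x' \<and> q' \<noteq> neg p'"
        using x "2.prems"(3)[of x' p' q'] e by auto
    qed (use "2.prems" in auto)
    then show ?case using x is_formula_ext_clauses[of x p q] by auto
  qed simp
  ultimately show ?thesis using T by blast
qed

lemma sat_ext_clauses:
  "(\<forall>D\<in>ext_clauses (x, p, q). sat \<nu> D) \<longleftrightarrow> (\<nu> x \<longleftrightarrow> holds \<nu> p \<and> holds \<nu> q)"
  unfolding ext_clauses_def by auto

lemma atm_lit_neq [simp]: "atm (lit_neq v b) = v"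
  by (simp add: lit_neq_def)

lemma holds_lit_neq [simp]: "holds \<nu> (lit_neq v b) \<longleftrightarrow> \<nu> v \<noteq> b"
  by (simp add: lit_neq_def)

text \<open>Cook's reduction on bits. Let \<open>N = 2 ^ k\<close>. After \<open>s\<close> rounds, the map \<open>f\<^sub>s\<close> sends the pigeons
  \<open>1, \<dots>, N + 1 - s\<close> injectively to the holes other than \<open>hole 0, \<dots>, hole (s - 1)\<close>; round \<open>s\<close> puts
  \<open>f\<^bsub>s + 1\<^esub> x = (if f\<^sub>s x = hole s then f\<^sub>s (N + 1 - s) else f\<^sub>s x)\<close>. Bit \<open>l\<close> of \<open>f\<^sub>s x\<close> is the variable
  \<open>bit (5 * s) x l\<close>; the layers in between hold the intermediate gates of the definition.\<close>

locale bit_pigeonhole =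
  fixes k :: nat and hole :: "nat \<Rightarrow> nat set"
  assumes k: "k \<ge> 1" and hole: "bij_betw hole {..<2 ^ k} (Pow {1..k})"
begin

definition N :: nat where "N = 2 ^ k"

text \<open>Layer \<open>0\<close> consists of the original variables. Pigeons \<open>1\<close> to
  \<open>N + 1\<close> fit below the stride \<open>N + 2\<close>, so \<open>div\<close> recovers the
  layer, and higher layers lie outside the formula.\<close>

definition bit :: "nat \<Rightarrow> nat \<Rightarrow> nat \<Rightarrow> nat \<times> nat" where
  "bit c x l = (x + (N + 2) * c, l)"

lemma bit_layer: "x \<le> N + 1 \<Longrightarrow> fst (bit c x l) div (N + 2) = c"
  unfolding bit_def fst_conv by (subst div_mult_self2) auto

lemma bit_inject:
  assumes "x \<le> N + 1" "y \<le> N + 1" "bit c x l = bit d y m"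
  shows "c = d \<and> x = y \<and> l = m"
proof -
  have "c = d" using bit_layer assms by metis
  then show ?thesis using assms(3) by (simp add: bit_def)
qed

definition neq :: "nat \<Rightarrow> nat \<Rightarrow> nat set \<Rightarrow> (nat \<times> nat) clause" where
  "neq c x H = (\<lambda>l. lit_neq (bit c x l) (l \<in> H)) ` {1..k}"

definition bits :: "(nat \<times> nat \<Rightarrow> bool) \<Rightarrow> nat \<Rightarrow> nat \<Rightarrow> nat set" where
  "bits \<nu> c x = {l \<in> {1..k}. \<nu> (bit c x l)}"

lemma sat_neq: "H \<subseteq> {1..k} \<Longrightarrow> sat \<nu> (neq c x H) \<longleftrightarrow> bits \<nu> c x \<noteq> H"
  unfolding neq_def bits_def by auto

lemma is_clause_neq: "is_clause (neq c x H \<union> neq c y H)"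
proof -
  have lit: "\<exists>t m. l = lit_neq (bit c t m) (m \<in> H)" if "l \<in> neq c x H \<union> neq c y H" for l
    using that unfolding neq_def by blast
  have "neg l \<noteq> l'" if "l \<in> neq c x H \<union> neq c y H" "l' \<in> neq c x H \<union> neq c y H" for l l'
    using lit[OF that(1)] lit[OF that(2)] by (auto simp: lit_neq_def bit_def split: if_splits)
  then have "\<not> tautological (neq c x H \<union> neq c y H)" unfolding tautological_def by blast
  then show ?thesis by (simp add: is_clause_def neq_def)
qed

text \<open>Extension clauses define conjunctions only. Gate \<open>0\<close> chains over
  \<open>l\<close> the test that bits \<open>1\<close> to \<open>l\<close> agree with
  \<open>hole s\<close>, repeating its literal at \<open>l = 1\<close>, where nothing precedes.
  Gates \<open>1\<close> and \<open>2\<close> are the branches of the \<open>if\<close>; their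
  disjunction takes gates \<open>3\<close> and \<open>4\<close> by De Morgan, the last being a
  negation written as a conjunction of equal literals.\<close>

definition gate :: "nat \<Rightarrow> nat \<Rightarrow> nat \<Rightarrow> nat \<Rightarrow>
    (nat \<times> nat) \<times> (nat \<times> nat) literal \<times> (nat \<times> nat) literal" where
  "gate s j x l = (bit (5 * s + 1 + j) x l,
     if j = 0 then
       (if l = 1 then lit_neq (bit (5 * s) x l) (l \<notin> hole s) else Pos (bit (5 * s + 1) x (l - 1)),
        lit_neq (bit (5 * s) x l) (l \<notin> hole s))
     else if j = 1 then (Pos (bit (5 * s + 1) x k), Pos (bit (5 * s) (N + 1 - s) l))
     else if j = 2 then (Neg (bit (5 * s + 1) x k), Pos (bit (5 * s) x l))
     else if j = 3 then (Neg (bit (5 * s + 2) x l), Neg (bit (5 * s + 3) x l))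
     else (Neg (bit (5 * s + 4) x l), Neg (bit (5 * s + 4) x l)))"

definition gates :: "((nat \<times> nat) \<times> (nat \<times> nat) literal \<times> (nat \<times> nat) literal) set" where
  "gates = (\<lambda>(s, j, x, l). gate s j x l) ` ({..<N} \<times> {..<5} \<times> {1..N} \<times> {1..k})"

lemma hole_subset: "s < N \<Longrightarrow> hole s \<subseteq> {1..k}"
  using hole unfolding bij_betw_def N_def by blast

lemma bits_step:
  assumes s: "s < N"
    and g: "\<And>j l D. j < 5 \<Longrightarrow> l \<in> {1..k} \<Longrightarrow> D \<in> ext_clauses (gate s j x l) \<Longrightarrow> sat \<nu> D"
  shows "bits \<nu> (5 * Suc s) x =
    (if bits \<nu> (5 * s) x = hole s then bits \<nu> (5 * s) (N + 1 - s) else bits \<nu> (5 * s) x)"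
proof -
  have g': "\<nu> (fst (gate s j x l)) \<longleftrightarrow>
      holds \<nu> (fst (snd (gate s j x l))) \<and> holds \<nu> (snd (snd (gate s j x l)))"
    if "j < 5" "l \<in> {1..k}" for j l
    using sat_ext_clauses[of "fst (gate s j x l)" "fst (snd (gate s j x l))"
        "snd (snd (gate s j x l))" \<nu>] g[OF that] by simp
  \<comment> \<open>The chain is evaluated prefix by prefix; its last member is the full test read
    by gates \<open>1\<close> and \<open>2\<close>.\<close>
  have E: "\<nu> (bit (5 * s + 1) x l) \<longleftrightarrow> (\<forall>m\<in>{1..l}. \<nu> (bit (5 * s) x m) \<longleftrightarrow> m \<in> hole s)"
    if "1 \<le> l" "l \<le> k" for l
    using that
  proof (induction l rule: nat_induct_at_least)
    case base
    then show ?case using g'[of 0 1] by (auto simp: gate_def)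
  next
    case (Suc l)
    have "{1..Suc l} = insert (Suc l) {1..l}" by auto
    then show ?case using Suc g'[of 0 "Suc l"] by (auto simp: gate_def)
  qed
  have "\<nu> (bit (5 * s + 1) x k) \<longleftrightarrow> (\<forall>m\<in>{1..k}. \<nu> (bit (5 * s) x m) \<longleftrightarrow> m \<in> hole s)"
    using E[of k] k by simp
  also have "\<dots> \<longleftrightarrow> bits \<nu> (5 * s) x = hole s"
    using hole_subset[OF s] by (auto simp: bits_def)
  finally have Ek: "\<nu> (bit (5 * s + 1) x k) \<longleftrightarrow> bits \<nu> (5 * s) x = hole s" .
  have "\<nu> (bit (5 * Suc s) x l) \<longleftrightarrow>
      (if bits \<nu> (5 * s) x = hole s then \<nu> (bit (5 * s) (N + 1 - s) l) else \<nu> (bit (5 * s) x l))"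
    if "l \<in> {1..k}" for l
  proof -
    have "5 * Suc s = 5 * s + 5" by simp
    then show ?thesis
      using that g'[of 1 l] g'[of 2 l] g'[of 3 l] g'[of 4 l] Ek
      by (auto simp: gate_def eval_nat_numeral)
  qed
  then have step: "bits \<nu> (5 * Suc s) x = {l \<in> {1..k}.
      if bits \<nu> (5 * s) x = hole s then \<nu> (bit (5 * s) (N + 1 - s) l) else \<nu> (bit (5 * s) x l)}"
    unfolding bits_def[of \<nu> "5 * Suc s"] by blast
  show ?thesis unfolding step
    by (cases "bits \<nu> (5 * s) x = hole s") (simp_all add: bits_def[of \<nu> "5 * s"])
qed

text \<open>Round \<open>s\<close> involves two surviving pigeons and the retiring one,
  \<open>N + 1 - s\<close>. Layer \<open>5 * s + 5\<close> belongs to it as the output that the next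
  round starts from.\<close>

definition local_vars :: "nat \<Rightarrow> nat \<Rightarrow> nat \<Rightarrow> (nat \<times> nat) set" where
  "local_vars s x y = (\<lambda>(c, t, l). bit c t l) ` ({5 * s..5 * s + 5} \<times> {x, y, N + 1 - s} \<times> {1..k})"

lemma bit_local: "c \<in> {5 * s..5 * s + 5} \<Longrightarrow> t \<in> {x, y, N + 1 - s} \<Longrightarrow> l \<in> {1..k} \<Longrightarrow> bit c t l \<in> local_vars s x y"
  unfolding local_vars_def by force

lemma neq_local: "c \<in> {5 * s..5 * s + 5} \<Longrightarrow> t \<in> {x, y, N + 1 - s} \<Longrightarrow> atm ` neq c t H \<subseteq> local_vars s x y"
  unfolding neq_def using bit_local by auto

lemma gate_local:
  assumes "j < 5" "t \<in> {x, y}" "l \<in> {1..k}" "D \<in> ext_clauses (gate s j t l)"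
  shows "atm ` D \<subseteq> local_vars s x y"
proof -
  have k': "k \<in> {1..k}" using k by simp
  have "atm ` D \<subseteq> vars (ext_clauses (gate s j t l))" using assms(4) unfolding vars_def by blast
  also have "\<dots> = {fst (gate s j t l), atm (fst (snd (gate s j t l))), atm (snd (snd (gate s j t l)))}"
    by (metis prod.collapse vars_ext_clauses)
  also have "\<dots> \<subseteq> local_vars s x y"
    using assms(1-3) k' by (auto simp: gate_def intro!: bit_local)
  finally show ?thesis .
qed

definition local_clauses :: "(nat \<times> nat) clause set" where
  "local_clauses = (\<Union>s<N. \<Union>x\<in>{1..N}. \<Union>y\<in>{1..N}. {C. is_clause C \<and> atm ` C \<subseteq> local_vars s x y})"

lemma finite_local_vars: "finite (local_vars s x y)"
  unfolding local_vars_def by auto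

lemma finite_local_clauses: "finite local_clauses"
  unfolding local_clauses_def using clauses_over(1)[OF finite_local_vars] by auto

text \<open>Six layers, three pigeons and \<open>k\<close> bits make at most \<open>18 * k\<close>
  variables, so at most \<open>4 ^ (18 * k) = N ^ 36\<close> clauses for each of the
  \<open>N ^ 3\<close> choices of \<open>s\<close>, \<open>x\<close>, \<open>y\<close>.\<close>

lemma card_local_clauses: "card local_clauses \<le> N ^ 39"
proof -
  have "card (local_vars s x y) \<le> 18 * k" for s x y
  proof -
    have "card (local_vars s x y) \<le> card ({5 * s..5 * s + 5} \<times> {x, y, N + 1 - s} \<times> {1..k})"
      unfolding local_vars_def by (rule card_image_le) auto
    also have "\<dots> = 6 * card {x, y, N + 1 - s} * k" by simp
    also have "\<dots> \<le> 6 * 3 * k" by (intro mult_le_mono) (auto simp: card_insert_if)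
    finally show ?thesis by simp
  qed
  then have "(4::nat) ^ card (local_vars s x y) \<le> 4 ^ (18 * k)" for s x y
    by (intro power_increasing) auto
  moreover have "(4::nat) ^ (18 * k) = N ^ 36"
  proof -
    have "(4::nat) ^ (18 * k) = (2 ^ 2) ^ (18 * k)" by simp
    also have "\<dots> = N ^ 36" unfolding N_def power_mult[symmetric] by (simp add: mult.commute)
    finally show ?thesis .
  qed
  ultimately have *: "card {C. is_clause C \<and> atm ` C \<subseteq> local_vars s x y} \<le> N ^ 36" for s x y
    using clauses_over(2)[OF finite_local_vars, of s x y] order_trans by fastforce
  have UN: "card (\<Union>i\<in>I. A i) \<le> card I * b" if "finite I" "\<And>i. card (A i) \<le> b"
    for I :: "nat set" and A :: "nat \<Rightarrow> (nat \<times> nat) clause set" and b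
  proof -
    have "card (\<Union>i\<in>I. A i) \<le> (\<Sum>i\<in>I. card (A i))" using that(1) by (rule card_UN_le)
    also have "\<dots> \<le> card I * b" using that sum_bounded_above[of I "\<lambda>i. card (A i)" b] by simp
    finally show ?thesis .
  qed
  have "card local_clauses \<le> card {..<N} * (card {1..N} * (card {1..N} * N ^ 36))"
    unfolding local_clauses_def by (intro UN *) auto
  also have "\<dots> = N ^ 39" by (simp add: eval_nat_numeral)
  finally show ?thesis .
qed

lemma BPHP_pow_neq:
  "x \<in> {1..N + 1} \<Longrightarrow> y \<in> {1..N + 1} \<Longrightarrow> x \<noteq> y \<Longrightarrow> neq 0 x H \<union> neq 0 y H \<in> BPHP_pow k"
  unfolding BPHP_pow_def neq_def bit_def N_def
  by (intro CollectI exI[of _ x] exI[of _ y] exI[of _ "\<lambda>l. l \<in> H"]) simp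

text \<open>The induction keeps two families in \<open>F\<close>: distinct remaining pigeons
  disagree, and none of them sits in the first \<open>s\<close> holes. Each passes to the next round
  as a consequence of clauses over \<open>local_vars s x y\<close>, so completeness supplies
  it.\<close>

lemma saturated_refutes:
  assumes closed: "closed_in local_clauses F" and F: "BPHP_pow k \<subseteq> F"
    and G: "\<And>t. t \<in> gates \<Longrightarrow> ext_clauses t \<subseteq> F"
  shows "{} \<in> F"
proof -
  have gates: "sat \<nu> D"
    if "s < N" "t \<in> {x, y}" "t \<in> {1..N}" "\<forall>D\<in>F. atm ` D \<subseteq> local_vars s x y \<longrightarrow> sat \<nu> D"
      "j < 5" "l \<in> {1..k}" "D \<in> ext_clauses (gate s j t l)" for s t x y \<nu> j l D
  proof -
    have "gate s j t l \<in> gates" using that unfolding gates_def by force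
    then have "D \<in> F" using G that(7) by blast
    then show ?thesis using that(4) gate_local[OF that(5,2,6,7)] by blast
  qed
  have complete: "C \<in> F"
    if "s < N" "x \<in> {1..N}" "y \<in> {1..N}" "is_clause C" "atm ` C \<subseteq> local_vars s x y"
      "\<And>\<nu>. \<forall>D\<in>F. atm ` D \<subseteq> local_vars s x y \<longrightarrow> sat \<nu> D \<Longrightarrow> sat \<nu> C" for s x y C
  proof (rule local_completeness[OF closed finite_local_vars[of s x y] _ that(4,5,6)])
    show "C \<in> local_clauses" if "is_clause C" "atm ` C \<subseteq> local_vars s x y" for C
      using that \<open>s < N\<close> \<open>x \<in> {1..N}\<close> \<open>y \<in> {1..N}\<close> unfolding local_clauses_def by blast
  qed
  have "(\<forall>x\<in>{1..N + 1 - s}. \<forall>y\<in>{1..N + 1 - s}. \<forall>H\<subseteq>{1..k}. x \<noteq> y \<longrightarrow>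
        neq (5 * s) x H \<union> neq (5 * s) y H \<in> F) \<and>
      (\<forall>x\<in>{1..N + 1 - s}. \<forall>i<s. neq (5 * s) x (hole i) \<in> F)" if "s \<le> N" for s
    using that
  proof (induction s)
    case 0
    then show ?case using BPHP_pow_neq F by auto
  next
    case (Suc s)
    then have s: "s < N" by simp
    define z where "z = N + 1 - s"
    have range: "t \<in> {1..z}" "t \<noteq> z" "t \<in> {1..N}" if "t \<in> {1..N + 1 - Suc s}" for t
      using that s by (auto simp: z_def)
    have z: "z \<in> {1..z}" using s by (simp add: z_def)
    have inj: "neq (5 * s) x H \<union> neq (5 * s) y H \<in> F"
      if "x \<in> {1..z}" "y \<in> {1..z}" "x \<noteq> y" "H \<subseteq> {1..k}" for x y H
      using Suc that by (auto simp: z_def)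
    have avoid: "neq (5 * s) x (hole i) \<in> F" if "x \<in> {1..z}" "i < s" for x i
      using Suc that by (auto simp: z_def)
    have inj_sat: "bits \<nu> (5 * s) t \<noteq> bits \<nu> (5 * s) u"
      if \<nu>: "\<forall>D\<in>F. atm ` D \<subseteq> local_vars s x y \<longrightarrow> sat \<nu> D"
        and tu: "t \<in> {x, y, z}" "u \<in> {x, y, z}" "t \<in> {1..z}" "u \<in> {1..z}" "t \<noteq> u"
      for \<nu> x y t u
    proof -
      let ?H = "bits \<nu> (5 * s) t"
      have H: "?H \<subseteq> {1..k}" by (auto simp: bits_def)
      have "atm ` (neq (5 * s) t ?H \<union> neq (5 * s) u ?H) \<subseteq> local_vars s x y"
        unfolding image_Un using tu by (intro Un_least neq_local) (auto simp: z_def)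
      then have "sat \<nu> (neq (5 * s) t ?H \<union> neq (5 * s) u ?H)"
        using \<nu> inj[OF tu(3,4,5) H] by blast
      then show ?thesis using sat_neq[OF H] by blast
    qed
    have avoid_sat: "bits \<nu> (5 * s) t \<noteq> hole i"
      if \<nu>: "\<forall>D\<in>F. atm ` D \<subseteq> local_vars s x y \<longrightarrow> sat \<nu> D"
        and t: "t \<in> {x, y, z}" "t \<in> {1..z}" "i < s"
      for \<nu> x y t i
    proof -
      have "atm ` neq (5 * s) t (hole i) \<subseteq> local_vars s x y"
        using t by (intro neq_local) (auto simp: z_def)
      then have "sat \<nu> (neq (5 * s) t (hole i))" using \<nu> avoid[OF t(2,3)] by blast
      then show ?thesis using sat_neq[OF hole_subset[of i]] t(3) s by auto
    qed
    have step: "bits \<nu> (5 * Suc s) t =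
        (if bits \<nu> (5 * s) t = hole s then bits \<nu> (5 * s) z else bits \<nu> (5 * s) t)"
      if "\<forall>D\<in>F. atm ` D \<subseteq> local_vars s x y \<longrightarrow> sat \<nu> D" "t \<in> {x, y}" "t \<in> {1..N}" for \<nu> x y t
      unfolding z_def using that s by (intro bits_step gates) auto
    have layer: "5 * Suc s \<in> {5 * s..5 * s + 5}" by simp
    show ?case
    proof (intro conjI ballI allI impI)
      fix x y H assume x: "x \<in> {1..N + 1 - Suc s}" and y: "y \<in> {1..N + 1 - Suc s}"
        and H: "H \<subseteq> {1..k}" and "x \<noteq> y"
      show "neq (5 * Suc s) x H \<union> neq (5 * Suc s) y H \<in> F"
      proof (rule complete[OF s range(3)[OF x] range(3)[OF y] is_clause_neq])
        show "atm ` (neq (5 * Suc s) x H \<union> neq (5 * Suc s) y H) \<subseteq> local_vars s x y"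
          unfolding image_Un by (intro Un_least neq_local layer) auto
        fix \<nu> assume \<nu>: "\<forall>D\<in>F. atm ` D \<subseteq> local_vars s x y \<longrightarrow> sat \<nu> D"
        \<comment> \<open>Whichever of \<open>x\<close> and \<open>y\<close> sat in
          \<open>hole s\<close> moves to the place of \<open>z\<close>, so both must differ from
          \<open>z\<close> as well.\<close>
        have "bits \<nu> (5 * s) x \<noteq> bits \<nu> (5 * s) y" "bits \<nu> (5 * s) x \<noteq> bits \<nu> (5 * s) z"
          "bits \<nu> (5 * s) y \<noteq> bits \<nu> (5 * s) z"
          using range[OF x] range[OF y] z \<open>x \<noteq> y\<close>
            inj_sat[OF \<nu>, of x y] inj_sat[OF \<nu>, of x z] inj_sat[OF \<nu>, of y z] by auto
        then have "bits \<nu> (5 * Suc s) x \<noteq> bits \<nu> (5 * Suc s) y"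
          using step[OF \<nu>, of x] step[OF \<nu>, of y] range[OF x] range[OF y] by auto
        then show "sat \<nu> (neq (5 * Suc s) x H \<union> neq (5 * Suc s) y H)"
          using sat_neq[OF H] by blast
      qed
    next
      fix x i assume x: "x \<in> {1..N + 1 - Suc s}" and i: "i < Suc s"
      have "is_clause (neq (5 * Suc s) x (hole i))"
        using is_clause_neq[of "5 * Suc s" x "hole i" x] by simp
      then show "neq (5 * Suc s) x (hole i) \<in> F"
      proof (rule complete[OF s range(3)[OF x] range(3)[OF x]])
        show "atm ` neq (5 * Suc s) x (hole i) \<subseteq> local_vars s x x"
          by (intro neq_local layer) auto
        fix \<nu> assume \<nu>: "\<forall>D\<in>F. atm ` D \<subseteq> local_vars s x x \<longrightarrow> sat \<nu> D"
        \<comment> \<open>This settles \<open>i = s\<close>: had \<open>x\<close> been in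
          \<open>hole s\<close>, it would move to the place of \<open>z\<close>, which is a
          different hole.\<close>
        have "bits \<nu> (5 * s) x \<noteq> bits \<nu> (5 * s) z"
          using range[OF x] z by (intro inj_sat[OF \<nu>]) auto
        moreover have "bits \<nu> (5 * s) x \<noteq> hole i" "bits \<nu> (5 * s) z \<noteq> hole i" if "i < s"
          using range[OF x] z that avoid_sat[OF \<nu>, of x i] avoid_sat[OF \<nu>, of z i] by auto
        ultimately have "bits \<nu> (5 * Suc s) x \<noteq> hole i"
          using step[OF \<nu>, of x] range[OF x] i less_Suc_eq by auto
        then show "sat \<nu> (neq (5 * Suc s) x (hole i))"
          using sat_neq[OF hole_subset[of i]] i s by auto
      qed
    qed
  qed
  from this[of N] have last: "neq (5 * N) 1 (hole i) \<in> F" if "i < N" for i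
    using that by simp
  have N: "N \<ge> 1" by (simp add: N_def)
  \<comment> \<open>Round \<open>N - 1\<close> is the last; its top layer
    \<open>5 * (N - 1) + 5\<close> is layer \<open>5 * N\<close>, where the one remaining pigeon
    avoids every hole.\<close>
  show ?thesis
  proof (rule complete[of "N - 1" 1 1])
    fix \<nu> assume \<nu>: "\<forall>D\<in>F. atm ` D \<subseteq> local_vars (N - 1) 1 1 \<longrightarrow> sat \<nu> D"
    have "bits \<nu> (5 * N) 1 \<in> Pow {1..k}" by (auto simp: bits_def)
    then obtain i where i: "i < N" "bits \<nu> (5 * N) 1 = hole i"
      using hole unfolding bij_betw_def N_def by (metis imageE lessThan_iff)
    have "atm ` neq (5 * N) 1 (hole i) \<subseteq> local_vars (N - 1) 1 1"
      using N by (intro neq_local) auto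
    then have "sat \<nu> (neq (5 * N) 1 (hole i))" using \<nu> last[OF i(1)] by blast
    then have "bits \<nu> (5 * N) 1 \<noteq> hole i" using sat_neq[OF hole_subset[OF i(1)]] by blast
    with i(2) show "sat \<nu> {}" by blast
  qed (use N in \<open>auto simp: is_clause_def\<close>)
qed

lemma ER_proof_BPHP_pow: "\<exists>\<pi>. ER_proof (BPHP_pow k) \<pi> \<and> ER_size \<pi> \<le> N ^ 40"
proof -
  \<comment> \<open>Layers dominate; within a layer the bit number decides, since the equality test
    refers to the preceding bit of its own layer.\<close>
  define r where "r v = (fst v div (N + 2)) * (k + 1) + snd v" for v
  have r: "r (bit c x l) = c * (k + 1) + l" if "x \<le> N + 1" for c x l
    using bit_layer[OF that] by (simp add: r_def) (simp add: bit_def)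
  have "\<exists>es. set es = gates \<and> is_extension (BPHP_pow k) es"
  proof (rule is_extension_ranked[where r = r])
    show "finite gates" unfolding gates_def by auto
    show "inj_on fst gates"
    proof (rule inj_onI)
      fix t u assume tu: "t \<in> gates" "u \<in> gates" "fst t = fst u"
      then obtain s j x l s' j' x' l' where
        t: "t = gate s j x l" "j < 5" "x \<in> {1..N}" and u: "u = gate s' j' x' l'" "j' < 5" "x' \<in> {1..N}"
        unfolding gates_def by auto
      from tu(3) have "5 * s + 1 + j = 5 * s' + 1 + j' \<and> x = x' \<and> l = l'"
        using t u by (intro bit_inject) (auto simp: gate_def)
      moreover from this have "s = s' \<and> j = j'" using t(2) u(2) by presburger
      ultimately show "t = u" using t(1) u(1) by simp
    qed
    fix v p q assume "(v, p, q) \<in> gates"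
    then obtain s j x l where g: "(v, p, q) = gate s j x l" and
      *: "s < N" "j < 5" "x \<in> {1..N}" "l \<in> {1..k}"
      unfolding gates_def by auto
    have less: "r (bit c x l) < r (bit d y m)" if "x \<le> N + 1" "y \<le> N + 1" "c < d" "l \<le> k" for c d x y l m
    proof -
      have "Suc c * (k + 1) \<le> d * (k + 1)" using that(3) by (intro mult_le_mono) auto
      then show ?thesis using that by (simp add: r)
    qed
    have ne: "bit c x l \<noteq> bit d y m" if "x \<le> N + 1" "y \<le> N + 1" "c \<noteq> d" for c d x y l m
      using bit_inject that by blast
    have "fst v \<ge> N + 2" using g by (auto simp: gate_def bit_def)
    then have "v \<notin> vars (BPHP_pow k)"
      unfolding vars_def BPHP_pow_def N_def by auto
    moreover have "r (atm p) < r v \<and> r (atm q) < r v \<and> q \<noteq> neg p"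
    proof -
      have x: "x \<le> N + 1" "N + 1 - s \<le> N + 1" and l: "1 \<le> l" "l \<le> k" using * by auto
      have prev: "r (bit (5 * s + 1) x (l - 1)) < r (bit (5 * s + 1) x l)"
        unfolding r[OF x(1)] using l by simp
      consider "j = 0" "l = 1" | "j = 0" "l \<noteq> 1" | "j = 1" | "j = 2" | "j = 3" | "j = 4"
        using *(2) by linarith
      \<comment> \<open>Either the atoms differ or the literal is repeated; both exclude
        \<open>q = neg p\<close>.\<close>
      then have "r (atm p) < r v \<and> r (atm q) < r v \<and> (atm p \<noteq> atm q \<or> p = q)"
      proof cases
        assume "j = 0" "l = 1"
        then have "v = bit (5 * s + 1) x l" "p = q" "atm q = bit (5 * s) x l"
          using g by (auto simp: gate_def)
        then show ?thesis using less x l by simp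
      next
        assume "j = 0" "l \<noteq> 1"
        then have "v = bit (5 * s + 1) x l" "atm p = bit (5 * s + 1) x (l - 1)" "atm q = bit (5 * s) x l"
          using g by (auto simp: gate_def)
        then show ?thesis using less x l prev ne by simp
      next
        assume "j = 1"
        then have "v = bit (5 * s + 2) x l" "atm p = bit (5 * s + 1) x k" "atm q = bit (5 * s) (N + 1 - s) l"
          using g by (auto simp: gate_def)
        then show ?thesis using less x l ne by simp
      next
        assume "j = 2"
        then have "v = bit (5 * s + 3) x l" "atm p = bit (5 * s + 1) x k" "atm q = bit (5 * s) x l"
          using g by (auto simp: gate_def eval_nat_numeral)
        then show ?thesis using less x l ne by simp
      next
        assume "j = 3"
        then have "v = bit (5 * s + 4) x l" "atm p = bit (5 * s + 2) x l" "atm q = bit (5 * s + 3) x l"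
          using g by (auto simp: gate_def eval_nat_numeral)
        then show ?thesis using less x l ne by simp
      next
        assume "j = 4"
        then have "v = bit (5 * s + 5) x l" "p = q" "atm q = bit (5 * s + 4) x l"
          using g by (auto simp: gate_def eval_nat_numeral)
        then show ?thesis using less x l ne by simp
      qed
      then show ?thesis by auto
    qed
    ultimately show "v \<notin> vars (BPHP_pow k) \<and> r (atm p) < r v \<and> r (atm q) < r v \<and> q \<noteq> neg p" by simp
  qed
  then obtain es where es: "set es = gates" "is_extension (BPHP_pow k) es" by blast
  have "\<exists>P. proof_by resolution_rule (BPHP_pow k \<union> ext_formula es) P \<and> length P \<le> Suc (card local_clauses)"
  proof (rule resolution_proof_by_saturation[OF finite_local_clauses])
    fix F assume "BPHP_pow k \<union> ext_formula es \<subseteq> F" "closed_in local_clauses F"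
    then show "{} \<in> F" using es(1) by (intro saturated_refutes) (auto simp: ext_formula_def)
  qed
  then obtain P where P: "proof_by resolution_rule (BPHP_pow k \<union> ext_formula es) P"
    "length P \<le> Suc (card local_clauses)" by blast
  have N2: "2 \<le> N" using power_increasing[OF k, of "2::nat"] by (simp add: N_def)
  have kN: "k \<le> N" unfolding N_def by (simp add: less_imp_le)
  have "card gates \<le> card ({..<N} \<times> {..<5::nat} \<times> {1..N} \<times> {1..k})"
    unfolding gates_def by (rule card_image_le) auto
  also have "\<dots> = 5 * (N * N * k)" by simp
  also have "\<dots> \<le> 5 * (N * N * N)" using kN by simp
  finally have gates: "card gates \<le> 5 * N ^ 3" by (simp add: eval_nat_numeral)
  have "card (ext_clauses t) \<le> 3" for t :: "(nat \<times> nat) \<times> (nat \<times> nat) literal \<times> (nat \<times> nat) literal"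
    unfolding ext_clauses_def by (auto simp: card_insert_if split: prod.split)
  then have "(\<Sum>t\<in>gates. card (ext_clauses t)) \<le> card gates * 3"
    using sum_bounded_above[of gates "\<lambda>t. card (ext_clauses t)" 3] by simp
  moreover have "card (ext_formula es) \<le> (\<Sum>t\<in>gates. card (ext_clauses t))"
    unfolding ext_formula_def es(1) by (rule card_UN_le) (simp add: gates_def)
  ultimately have "card (ext_formula es) \<le> 15 * N ^ 3" using gates by linarith
  then have "ER_size (es, P) \<le> 15 * N ^ 3 + Suc (N ^ 39)"
    using P(2) card_local_clauses by (simp add: ER_size_def)
  also have "\<dots> \<le> N ^ 40"
  proof -
    have "(2::nat) ^ 36 \<le> N ^ 36" using N2 by (rule power_mono) simp
    then have "16 * N ^ 3 \<le> N ^ 36 * N ^ 3" by (intro mult_le_mono) auto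
    then have "16 * N ^ 3 \<le> N ^ 39" by (simp flip: power_add)
    moreover have "1 \<le> N ^ 3" using N2 by simp
    moreover have "2 * N ^ 39 \<le> N * N ^ 39" using N2 by (rule mult_le_mono1)
    then have "2 * N ^ 39 \<le> N ^ 40" by (simp flip: power_Suc)
    ultimately show ?thesis by linarith
  qed
  finally have "ER_size (es, P) \<le> N ^ 40" .
  moreover have "ER_proof (BPHP_pow k) (es, P)" using es(2) P(1) by (simp add: ER_proof_def)
  ultimately show ?thesis by blast
qed

end

section \<open>The bit pigeonhole formula\<close>

definition bvars :: "nat \<Rightarrow> (nat \<times> nat) set" where
  "bvars k = {1..2 ^ k + 1} \<times> {1..k}"

lemma BPHP_powE:
  assumes "C \<in> BPHP_pow k"
  obtains x y h where "x \<in> {1..2 ^ k + 1}" "y \<in> {1..2 ^ k + 1}" "x \<noteq> y"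
    "C = (\<lambda>l. lit_neq (x, l) (h l)) ` {1..k} \<union> (\<lambda>l. lit_neq (y, l) (h l)) ` {1..k}"
  using assms unfolding BPHP_pow_def by blast

lemma BPHP_powI:
  "x \<in> {1..2 ^ k + 1} \<Longrightarrow> y \<in> {1..2 ^ k + 1} \<Longrightarrow> x \<noteq> y \<Longrightarrow>
    (\<lambda>l. lit_neq (x, l) (h l)) ` {1..k} \<union> (\<lambda>l. lit_neq (y, l) (h l)) ` {1..k} \<in> BPHP_pow k"
  unfolding BPHP_pow_def by blast

lemma is_formula_BPHP_pow: "is_formula (BPHP_pow k)"
proof -
  have C: "is_clause C \<and> atm ` C \<subseteq> bvars k" if C: "C \<in> BPHP_pow k" for C
  proof -
    obtain x y h where xy: "x \<in> {1..2 ^ k + 1}" "y \<in> {1..2 ^ k + 1}"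
      and eq: "C = (\<lambda>l. lit_neq (x, l) (h l)) ` {1..k} \<union> (\<lambda>l. lit_neq (y, l) (h l)) ` {1..k}"
      using C by (elim BPHP_powE)
    have lit: "\<exists>t m. l = lit_neq (t, m) (h m)" if "l \<in> C" for l
      using that unfolding eq by blast
    have "neg l \<noteq> l'" if "l \<in> C" "l' \<in> C" for l l'
      using lit[OF that(1)] lit[OF that(2)] by (auto simp: lit_neq_def split: if_splits)
    then have "\<not> tautological C" unfolding tautological_def by blast
    moreover have "finite C" unfolding eq by simp
    moreover have "atm ` C \<subseteq> bvars k" using xy unfolding eq bvars_def by auto
    ultimately show ?thesis by (simp add: is_clause_def)
  qed
  then have "BPHP_pow k \<subseteq> {C. is_clause C \<and> atm ` C \<subseteq> bvars k}" by blast
  moreover have "finite (bvars k)" by (simp add: bvars_def)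
  ultimately show ?thesis
    using C clauses_over(1) finite_subset unfolding is_formula_def by blast
qed

lemma vars_BPHP_pow: "vars (BPHP_pow k) = bvars k"
proof
  show "vars (BPHP_pow k) \<subseteq> bvars k"
    unfolding vars_def bvars_def by (auto elim!: BPHP_powE)
  show "bvars k \<subseteq> vars (BPHP_pow k)"
  proof
    fix v assume "v \<in> bvars k"
    then obtain x l where v: "v = (x, l)" "x \<in> {1..2 ^ k + 1}" "l \<in> {1..k}"
      by (auto simp: bvars_def)
    define y :: nat where "y = (if x = 1 then 2 else 1)"
    have "y \<in> {1..2 ^ k + 1}" "x \<noteq> y" using v(2) by (auto simp: y_def)
    note C = BPHP_powI[OF v(2) this, of "\<lambda>_. True"]
    have "atm (lit_neq (x, l) True) \<in> vars (BPHP_pow k)"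
      unfolding vars_def using C v(3) by blast
    then show "v \<in> vars (BPHP_pow k)" using v(1) by simp
  qed
qed

lemma unsatisfiable_BPHP_pow: "unsatisfiable (BPHP_pow k)"
  unfolding unsatisfiable_def
proof
  assume "\<exists>\<nu>. \<forall>C\<in>BPHP_pow k. sat \<nu> C"
  then obtain \<nu> where \<nu>: "\<forall>C\<in>BPHP_pow k. sat \<nu> C" by blast
  define f where "f x = {l \<in> {1..k}. \<nu> (x, l)}" for x
  have "card (f ` {1..2 ^ k + 1}) \<le> card (Pow {1..k})"
    by (rule card_mono) (auto simp: f_def)
  then have "\<not> inj_on f {1..2 ^ k + 1}" by (intro pigeonhole) (simp add: card_Pow)
  then obtain x y where xy: "x \<in> {1..2 ^ k + 1}" "y \<in> {1..2 ^ k + 1}" "x \<noteq> y" "f x = f y"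
    unfolding inj_on_def by blast
  have "\<nu> (x, l) = \<nu> (y, l)" if "l \<in> {1..k}" for l
  proof -
    have "l \<in> f x \<longleftrightarrow> l \<in> f y" using xy(4) by simp
    then show ?thesis using that by (simp add: f_def)
  qed
  moreover from \<nu> BPHP_powI[OF xy(1-3), of "\<lambda>l. \<nu> (x, l)"]
  have "sat \<nu> ((\<lambda>l. lit_neq (x, l) (\<nu> (x, l))) ` {1..k} \<union> (\<lambda>l. lit_neq (y, l) (\<nu> (x, l))) ` {1..k})"
    by blast
  ultimately show False by auto
qed

section \<open>Set-blocked clauses are wide\<close>

text \<open>The set on the right is the assignment falsifying \<open>C\<close>, flipped on
  \<open>L\<close>. Neither clause is tautological alone, so the tautology pairs a literal of
  \<open>C - L\<close> with its complement in \<open>D\<close>, which this assignment makes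
  true.\<close>

lemma SBC_satisfied:
  assumes SBC: "is_SBC F C L" and D: "D \<in> F" "is_clause D" "l \<in> L" "neg l \<in> D"
  shows "\<exists>d\<in>D. d \<in> L \<union> neg ` (C - L)"
proof (cases "D \<inter> L = {}")
  case True
  moreover have "D \<inter> neg ` L \<noteq> {}" using D(3,4) by blast
  ultimately have "tautological ((C - L) \<union> (D - neg ` L))"
    using SBC D(1) unfolding is_SBC_def by blast
  then obtain e where e: "e \<in> (C - L) \<union> (D - neg ` L)" "neg e \<in> (C - L) \<union> (D - neg ` L)"
    unfolding tautological_def by blast
  have C: "is_clause C" using SBC unfolding is_SBC_def by blast
  have "(e \<in> C - L \<and> neg e \<in> D) \<or> (neg e \<in> C - L \<and> e \<in> D)"
    using e is_clause_neg[OF C, of e] is_clause_neg[OF D(2), of e] by blast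
  then show ?thesis by (metis UnI2 imageI neg_neg)
qed blast

lemma SBC_consistent:
  assumes "is_SBC F C L" "l \<in> L \<union> neg ` (C - L)"
  shows "neg l \<notin> L \<union> neg ` (C - L)" "atm l \<in> atm ` C"
proof -
  have C: "is_clause C" "L \<subseteq> C" using assms(1) unfolding is_SBC_def by auto
  show "neg l \<notin> L \<union> neg ` (C - L)"
    using assms(2) C(2) is_clause_neg[OF C(1)] by (auto, (metis neg_neg subsetD)+)
  show "atm l \<in> atm ` C" using assms(2) C(2) by auto
qed

lemma SBC_guarded_not_ext_var:
  assumes SBC: "is_SBC F C L" and "guarded E \<Gamma> \<subseteq> F" "l \<in> L"
    and \<Gamma>: "unsatisfiable \<Gamma>" "is_formula \<Gamma>" and fresh: "ext_vars (fst (E \<Gamma>)) \<inter> vars \<Gamma> = {}"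
  shows "atm l \<notin> ext_vars (fst (E \<Gamma>))"
proof
  assume l: "atm l \<in> ext_vars (fst (E \<Gamma>))"
  define \<alpha> where "\<alpha> = L \<union> neg ` (C - L)"
  \<comment> \<open>Variables on which \<alpha> is silent default to false; only literals in
    \<alpha> are relied on.\<close>
  have "sat (\<lambda>v. Pos v \<in> \<alpha>) D" if D: "D \<in> \<Gamma>" for D
  proof -
    have "atm l \<notin> atm ` D" using l fresh D unfolding vars_def by blast
    then have "neg (neg l) \<notin> D" by force
    moreover have "is_clause D" using D \<Gamma>(2) by (simp add: is_formula_def)
    ultimately have cl: "is_clause (insert (neg l) D)"
      unfolding is_clause_def tautological_insert by simp
    \<comment> \<open>Of the two guards, the one with the complement of \<open>l\<close> is
      constrained by blockedness, and \<alpha> does not satisfy it through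
      \<open>neg l\<close>.\<close>
    then have "insert (neg l) D \<in> guarded E \<Gamma>"
      unfolding guarded_iff is_clause_def using l D by (metis atm_neg)
    then have "\<exists>d\<in>insert (neg l) D. d \<in> \<alpha>"
      unfolding \<alpha>_def using SBC_satisfied[OF SBC _ cl \<open>l \<in> L\<close>] assms(2) by blast
    moreover have "neg l \<notin> \<alpha>" using SBC_consistent(1)[OF SBC, of l] \<open>l \<in> L\<close> by (simp add: \<alpha>_def)
    ultimately obtain d where d: "d \<in> D" "d \<in> \<alpha>" by blast
    then have "holds (\<lambda>v. Pos v \<in> \<alpha>) d"
      using SBC_consistent(1)[OF SBC, of d] by (cases d) (auto simp: \<alpha>_def)
    then show ?thesis using d(1) by blast
  qed
  then show False using \<Gamma>(1) unfolding unsatisfiable_def by blast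
qed

definition touched :: "nat \<Rightarrow> (nat \<times> nat) clause \<Rightarrow> nat set" where
  "touched k C = fst ` (atm ` C \<inter> bvars k)"

lemma finite_touched: "finite (touched k C)"
  unfolding touched_def bvars_def by (intro finite_imageI finite_Int) simp

text \<open>For an unmentioned \<open>y\<close>, take the clause forbidding \<open>x\<close> and
  \<open>y\<close> to share the hole where \<alpha> puts \<open>x\<close>. None of its literals on
  \<open>x\<close> is true under \<alpha>, so one on \<open>y\<close> is, yet \<alpha> speaks only
  of variables of \<open>C\<close>.\<close>

lemma SBC_BPHP_touched:
  assumes SBC: "is_SBC F C L" and "BPHP_pow k \<subseteq> F" and l: "l \<in> L" "atm l \<in> bvars k"
  shows "{1..2 ^ k + 1} \<subseteq> touched k C"
proof
  fix y :: nat assume y: "y \<in> {1..2 ^ k + 1}"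
  obtain x m where x: "atm l = (x, m)" "x \<in> {1..2 ^ k + 1}" "m \<in> {1..k}"
    using l(2) unfolding bvars_def by auto
  have lC: "l \<in> C" using SBC l(1) unfolding is_SBC_def by blast
  show "y \<in> touched k C"
  proof (rule ccontr)
    assume ny: "y \<notin> touched k C"
    have "x \<in> touched k C" unfolding touched_def using lC x(1) l(2) by (metis IntI fst_conv imageI)
    then have xy: "x \<noteq> y" using ny by blast
    define \<alpha> where "\<alpha> = L \<union> neg ` (C - L)"
    have cons: "neg d \<notin> \<alpha>" "atm d \<in> atm ` C" if "d \<in> \<alpha>" for d
      using SBC_consistent[OF SBC, of d] that unfolding \<alpha>_def by auto
    \<comment> \<open>Bits of \<open>x\<close> left open by \<alpha> are read as 0; the resulting
      literal \<open>Pos (x, i)\<close> is then not in \<alpha> either.\<close>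
    define h where "h i \<longleftrightarrow> Pos (x, i) \<in> \<alpha>" for i
    define D where "D = (\<lambda>l. lit_neq (x, l) (h l)) ` {1..k} \<union> (\<lambda>l. lit_neq (y, l) (h l)) ` {1..k}"
    have D: "D \<in> BPHP_pow k" unfolding D_def using x(2) y xy by (rule BPHP_powI)
    have "l \<in> \<alpha>" using l(1) by (simp add: \<alpha>_def)
    then have "neg l = lit_neq (x, m) (h m)"
      using x(1) cons(1)[of l] unfolding h_def lit_neq_def by (cases l) auto
    then have "neg l \<in> D" unfolding D_def using x(3) by blast
    moreover have "is_clause D" using D is_formula_BPHP_pow unfolding is_formula_def by blast
    ultimately obtain d where d: "d \<in> D" "d \<in> \<alpha>"
      using SBC_satisfied[OF SBC _ _ l(1)] D assms(2) unfolding \<alpha>_def by blast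
    from d(1) obtain i where i: "i \<in> {1..k}" "d = lit_neq (x, i) (h i) \<or> d = lit_neq (y, i) (h i)"
      unfolding D_def by blast
    from i(2) show False
    proof
      assume "d = lit_neq (x, i) (h i)"
      then show False using d(2) cons(1)[OF d(2)] by (auto simp: h_def lit_neq_def split: if_splits)
    next
      assume "d = lit_neq (y, i) (h i)"
      then have "(y, i) \<in> atm ` C \<inter> bvars k" using cons(2)[OF d(2)] y i(1) by (simp add: bvars_def)
      then have "y \<in> touched k C" unfolding touched_def by (metis fst_conv imageI)
      with ny show False by blast
    qed
  qed
qed

section \<open>A partial matching satisfying all wide clauses\<close>

definition matching :: "nat \<Rightarrow> (nat \<rightharpoonup> nat set) \<Rightarrow> bool" where
  "matching k M \<longleftrightarrow> dom M \<subseteq> {1..2 ^ k + 1} \<and> ran M \<subseteq> Pow {1..k} \<and> inj_on M (dom M)"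

lemma matching_finite: "matching k M \<Longrightarrow> finite (dom M)"
  unfolding matching_def using finite_subset by blast

lemma matching_card_ran: "matching k M \<Longrightarrow> finite (ran M) \<and> card (ran M) \<le> card (dom M)"
proof -
  assume M: "matching k M"
  have "ran M = (\<lambda>x. the (M x)) ` dom M" unfolding ran_def dom_def by force
  then show ?thesis using matching_finite[OF M] card_image_le by simp
qed

lemma matching_upd:
  assumes "matching k M" "x \<in> {1..2 ^ k + 1} - dom M" "H \<in> Pow {1..k} - ran M"
  shows "matching k (M(x \<mapsto> H))"
proof -
  have "x \<notin> dom M" using assms(2) by blast
  moreover have "Some H \<notin> M ` dom M" using assms(3) by (auto simp: ran_def)
  moreover have "inj_on (M(x \<mapsto> H)) (dom M) \<longleftrightarrow> inj_on M (dom M)"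
    using calculation by (intro inj_on_cong) auto
  moreover have "(M(x \<mapsto> H)) ` dom M = M ` dom M" using calculation by (intro image_cong) auto
  moreover have "ran (M(x \<mapsto> H)) = insert H (ran M)" using calculation(1) by (intro ran_map_upd) auto
  ultimately show ?thesis using assms unfolding matching_def by (auto simp: inj_on_insert)
qed

lemma matching_restrict:
  assumes "matching k M"
  shows "matching k (M |` A)"
proof -
  have "inj_on M (dom M \<inter> A)" using assms unfolding matching_def by (auto intro: inj_on_subset)
  then have "inj_on (M |` A) (dom M \<inter> A)" by (rule inj_on_cong[THEN iffD1, rotated]) simp
  moreover have "ran (M |` A) \<subseteq> ran M" by (auto simp: ran_def restrict_map_def)
  ultimately show ?thesis using assms unfolding matching_def by auto
qed

lemma matching_extend:
  assumes M: "matching k M" "card (dom M) < 2 ^ k" and x: "x \<in> {1..2 ^ k + 1}"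
  shows "\<exists>M'. matching k M' \<and> M \<subseteq>\<^sub>m M' \<and> x \<in> dom M' \<and> card (dom M') \<le> Suc (card (dom M))"
proof (cases "x \<in> dom M")
  case False
  have "card (ran M) < card (Pow {1..k})"
    using matching_card_ran[OF M(1)] M(2) by (simp add: card_Pow)
  then obtain H where "H \<in> Pow {1..k} - ran M"
    using matching_card_ran[OF M(1)] by (metis Diff_eq_empty_iff card_mono equals0I linorder_not_less)
  then have "matching k (M(x \<mapsto> H))" using matching_upd[OF M(1)] False x by blast
  moreover have "M \<subseteq>\<^sub>m M(x \<mapsto> H)" using False by (auto simp: map_le_def)
  ultimately show ?thesis
    using matching_finite[OF M(1)] by (intro exI[of _ "M(x \<mapsto> H)"]) (simp add: card_insert_if)
qed (use M in auto)

definition bit_sat :: "nat \<Rightarrow> nat \<Rightarrow> nat set \<Rightarrow> (nat \<times> nat) clause \<Rightarrow> bool" where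
  "bit_sat k x H C \<longleftrightarrow> (\<exists>lit\<in>C. \<exists>l\<in>{1..k}. atm lit = (x, l) \<and> holds (\<lambda>_. l \<in> H) lit)"

definition match_sat :: "nat \<Rightarrow> (nat \<rightharpoonup> nat set) \<Rightarrow> (nat \<times> nat) clause \<Rightarrow> bool" where
  "match_sat k M C \<longleftrightarrow> (\<exists>x H. M x = Some H \<and> bit_sat k x H C)"

lemma card_bit_subsets:
  assumes "l \<in> {1..k}"
  shows "card {H \<in> Pow {1..k}. l \<in> H \<longleftrightarrow> b} = 2 ^ (k - 1)"
proof -
  have no: "card (Pow ({1..k} - {l})) = 2 ^ (k - 1)" using assms by (simp add: card_Pow)
  show ?thesis
  proof (cases b)
    case True
    have "{H \<in> Pow {1..k}. l \<in> H \<longleftrightarrow> b} = insert l ` Pow ({1..k} - {l})" (is "?A = ?B")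
    proof
      show "?A \<subseteq> ?B"
      proof
        fix H assume "H \<in> ?A"
        then have "H = insert l (H - {l})" "H - {l} \<in> Pow ({1..k} - {l})" using True by auto
        then show "H \<in> ?B" by (rule image_eqI)
      qed
      show "?B \<subseteq> ?A" using assms True by auto
    qed
    moreover have "inj_on (insert l) (Pow ({1..k} - {l}))"
      by (rule inj_onI) (metis DiffD2 PowD insert_ident insertI1 subsetD)
    ultimately show ?thesis using no by (simp add: card_image)
  next
    case False
    then have "{H \<in> Pow {1..k}. l \<in> H \<longleftrightarrow> b} = Pow ({1..k} - {l})" by auto
    then show ?thesis using no by simp
  qed
qed

text \<open>Of at least \<open>2 * q\<close> mentioned pigeons fewer than \<open>q\<close> are
  matched, so \<open>q + 1\<close> remain. For each of them fix one literal on it: half of the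
  holes, \<open>2 * q\<close>, make it true, and fewer than \<open>q\<close> are taken.\<close>

lemma card_sat_pairs:
  assumes M: "matching k M" "card (dom M) < q" and q: "2 ^ k = 4 * q"
    and C: "2 * q \<le> card (touched k C)"
  defines "T \<equiv> ({1..2 ^ k + 1} - dom M) \<times> (Pow {1..k} - ran M)"
  shows "(q + 1) * (q + 1) \<le> card {(x, H) \<in> T. bit_sat k x H C}"
proof -
  define A where "A = touched k C - dom M"
  define B where "B x = {H \<in> Pow {1..k} - ran M. bit_sat k x H C}" for x
  have "card (touched k C) - card (dom M) \<le> card A"
    unfolding A_def by (rule diff_card_le_card_Diff[OF matching_finite[OF M(1)]])
  then have A: "q + 1 \<le> card A" using C M(2) by linarith
  have finA: "finite A" unfolding A_def using finite_touched by blast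
  have B: "q + 1 \<le> card (B x)" if x: "x \<in> A" for x
  proof -
    obtain lit l where lit: "lit \<in> C" "atm lit = (x, l)" "l \<in> {1..k}"
    proof -
      obtain v where "v \<in> atm ` C" "v \<in> bvars k" "x = fst v"
        using x unfolding A_def touched_def by blast
      then show ?thesis using that unfolding bvars_def by (metis imageE mem_Times_iff prod.collapse)
    qed
    let ?S = "{H \<in> Pow {1..k}. l \<in> H \<longleftrightarrow> (\<exists>v. lit = Pos v)}"
    have "?S - ran M \<subseteq> B x"
    proof
      fix H assume H: "H \<in> ?S - ran M"
      then have "holds (\<lambda>_. l \<in> H) lit" by (cases lit) auto
      then show "H \<in> B x" unfolding B_def bit_sat_def using H lit by blast
    qed
    then have "card (?S - ran M) \<le> card (B x)" by (rule card_mono[rotated]) (simp add: B_def)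
    moreover have "card ?S - card (ran M) \<le> card (?S - ran M)"
      using matching_card_ran[OF M(1)] by (intro diff_card_le_card_Diff) blast
    moreover have "card ?S = 2 * q"
    proof -
      have "2 * 2 ^ (k - 1) = (2::nat) ^ k" using lit(3) by (simp flip: power_Suc)
      then show ?thesis using card_bit_subsets[OF lit(3)] q by simp
    qed
    ultimately show ?thesis using matching_card_ran[OF M(1)] M(2) by linarith
  qed
  have "(q + 1) * (q + 1) \<le> card A * (q + 1)" using A by (rule mult_le_mono1)
  also have "\<dots> \<le> (\<Sum>x\<in>A. card (B x))" using sum_mono[of A "\<lambda>_. q + 1" "\<lambda>x. card (B x)"] B by simp
  also have "\<dots> = card (Sigma A B)"
    using finA by (intro card_SigmaI[symmetric]) (auto simp: B_def)
  also have "\<dots> \<le> card {(x, H) \<in> T. bit_sat k x H C}"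
  proof (rule card_mono)
    have "finite T" unfolding T_def by simp
    then show "finite {(x, H) \<in> T. bit_sat k x H C}" by (rule rev_finite_subset) auto
    have "fst ` bvars k \<subseteq> {1..2 ^ k + 1}" unfolding bvars_def by auto
    then have "touched k C \<subseteq> {1..2 ^ k + 1}" unfolding touched_def by blast
    then show "Sigma A B \<subseteq> {(x, H) \<in> T. bit_sat k x H C}"
      unfolding A_def B_def T_def by blast
  qed
  finally show ?thesis .
qed

text \<open>Fewer than \<open>16 * ((q + 1) * (q + 1))\<close> pairs are free, and each open clause
  is satisfied by \<open>(q + 1) * (q + 1)\<close> of them. By averaging, some pair satisfies a
  sixteenth of the open clauses.\<close>

lemma greedy_matching:
  assumes q: "2 ^ k = 4 * q" and W: "finite W" "\<And>C. C \<in> W \<Longrightarrow> 2 * q \<le> card (touched k C)"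
    and "j \<le> q"
  shows "\<exists>M. matching k M \<and> card (dom M) = j \<and>
    card {C \<in> W. \<not> match_sat k M C} * 16 ^ j \<le> 15 ^ j * card W"
  using \<open>j \<le> q\<close>
proof (induction j)
  case 0
  have "matching k Map.empty" by (simp add: matching_def)
  moreover have "card {C \<in> W. \<not> match_sat k Map.empty C} \<le> card W"
    using W(1) by (intro card_mono) auto
  ultimately show ?case by (intro exI[of _ Map.empty]) simp
next
  case (Suc j)
  then obtain M where M: "matching k M" "card (dom M) = j"
    "card {C \<in> W. \<not> match_sat k M C} * 16 ^ j \<le> 15 ^ j * card W" by auto
  define U where "U = {C \<in> W. \<not> match_sat k M C}"
  define T where "T = ({1..2 ^ k + 1} - dom M) \<times> (Pow {1..k} - ran M)"
  define S where "S x H = {C \<in> U. bit_sat k x H C}" for x H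
  have finU: "finite U" and finT: "finite T" using W(1) by (auto simp: U_def T_def)
  have "card ({1..2 ^ k + 1} - dom M) * card (Pow {1..k} - ran M) \<le> (4 * q + 1) * (4 * q)"
  proof (intro mult_le_mono)
    have "card ({1..2 ^ k + 1} - dom M) \<le> card {1..2 ^ k + 1::nat}" by (rule card_mono) auto
    then show "card ({1..2 ^ k + 1} - dom M) \<le> 4 * q + 1" using q by simp
    have "card (Pow {1..k} - ran M) \<le> card (Pow {1..k})" by (rule card_mono) auto
    then show "card (Pow {1..k} - ran M) \<le> 4 * q" using q by (simp add: card_Pow)
  qed
  also have "\<dots> < 16 * ((q + 1) * (q + 1))" by (simp add: algebra_simps)
  finally have cardT: "card T < 16 * ((q + 1) * (q + 1))"
    unfolding T_def by (simp add: card_cartesian_product)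
  \<comment> \<open>Incidences of pairs and clauses, counted by pairs and by clauses.\<close>
  have count: "(\<Sum>(x, H)\<in>T. card (S x H)) = (\<Sum>C\<in>U. card {(x, H) \<in> T. bit_sat k x H C})"
  proof -
    have filter: "card {a \<in> A. R a} = (\<Sum>a\<in>A. if R a then 1 else 0)"
      if "finite A" for A :: "'c set" and R
      using that by (simp add: sum.If_cases Int_def)
    have "(\<Sum>(x, H)\<in>T. card (S x H)) = (\<Sum>t\<in>T. \<Sum>C\<in>U. if bit_sat k (fst t) (snd t) C then 1 else 0)"
      unfolding case_prod_beta S_def filter[OF finU] ..
    also have "\<dots> = (\<Sum>C\<in>U. \<Sum>t\<in>T. if bit_sat k (fst t) (snd t) C then 1 else 0)"
      by (rule sum.swap)
    also have "\<dots> = (\<Sum>C\<in>U. card {t \<in> T. bit_sat k (fst t) (snd t) C})"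
      unfolding filter[OF finT] ..
    also have "\<dots> = (\<Sum>C\<in>U. card {(x, H) \<in> T. bit_sat k x H C})"
      by (simp add: case_prod_unfold)
    finally show ?thesis .
  qed
  have "(q + 1) * (q + 1) \<le> card {(x, H) \<in> T. bit_sat k x H C}" if "C \<in> U" for C
    unfolding T_def using M Suc.prems W(2)[of C] that
    by (intro card_sat_pairs[OF _ _ q]) (auto simp: U_def)
  then have lower: "card U * ((q + 1) * (q + 1)) \<le> (\<Sum>(x, H)\<in>T. card (S x H))"
    unfolding count using sum_mono[of U "\<lambda>_. (q + 1) * (q + 1)"] by simp
  have "\<exists>(x, H)\<in>T. card U \<le> 16 * card (S x H)"
  proof (rule ccontr)
    assume "\<not> ?thesis"
    then have small: "16 * card (S x H) < card U" if "(x, H) \<in> T" for x H using that by force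
    have "16 * (\<Sum>(x, H)\<in>T. card (S x H)) = (\<Sum>(x, H)\<in>T. 16 * card (S x H))"
      by (simp add: sum_distrib_left case_prod_beta)
    also have "\<dots> \<le> (\<Sum>t\<in>T. card U)"
      using small by (intro sum_mono) (auto intro: less_imp_le)
    finally have "16 * (\<Sum>(x, H)\<in>T. card (S x H)) \<le> card T * card U" by simp
    with lower have *: "(16 * ((q + 1) * (q + 1))) * card U \<le> card T * card U" by (simp add: algebra_simps)
    \<comment> \<open>Averaging leaves only the case without open clauses; a free pair is needed
      even there, because the domain must grow to exactly \<open>Suc j\<close>.\<close>
    have "card U = 0"
    proof (rule ccontr)
      assume "card U \<noteq> 0"
      then have "card T * card U < (16 * ((q + 1) * (q + 1))) * card U" using cardT by simp
      with * show False by simp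
    qed
    with small have "T = {}" by auto
    moreover have "card ({1..2 ^ k + 1} - dom M) > 0" "card (Pow {1..k} - ran M) > 0"
    proof -
      have "card {1..2 ^ k + 1::nat} - card (dom M) \<le> card ({1..2 ^ k + 1} - dom M)"
        by (rule diff_card_le_card_Diff[OF matching_finite[OF M(1)]])
      then show "card ({1..2 ^ k + 1} - dom M) > 0" using M(2) Suc.prems q by simp
      have "card (Pow {1..k}) - card (ran M) \<le> card (Pow {1..k} - ran M)"
        using matching_card_ran[OF M(1)] by (intro diff_card_le_card_Diff) blast
      then show "card (Pow {1..k} - ran M) > 0"
        using matching_card_ran[OF M(1)] M(2) Suc.prems q
        unfolding card_Pow[OF finite_atLeastAtMost] card_atLeastAtMost diff_Suc_1 by linarith
    qed
    then have "card T > 0" unfolding T_def card_cartesian_product by (rule mult_pos_pos)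
    ultimately show False by simp
  qed
  then obtain x H where xH: "(x, H) \<in> T" "card U \<le> 16 * card (S x H)" by blast
  have x: "x \<in> {1..2 ^ k + 1} - dom M" and H: "H \<in> Pow {1..k} - ran M"
    using xH(1) by (auto simp: T_def)
  let ?M = "M(x \<mapsto> H)"
  have "{C \<in> W. \<not> match_sat k ?M C} \<subseteq> U - S x H"
  proof
    fix C assume C: "C \<in> {C \<in> W. \<not> match_sat k ?M C}"
    have "\<not> bit_sat k x H C" using C unfolding match_sat_def by auto
    moreover have "\<not> match_sat k M C"
    proof
      assume "match_sat k M C"
      then obtain y K where "M y = Some K" "bit_sat k y K C" unfolding match_sat_def by blast
      moreover from this have "?M y = Some K" using x by auto
      ultimately show False using C unfolding match_sat_def by blast
    qed
    ultimately show "C \<in> U - S x H" using C by (simp add: U_def S_def)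
  qed
  then have "card {C \<in> W. \<not> match_sat k ?M C} \<le> card (U - S x H)" using finU by (simp add: card_mono)
  also have "\<dots> = card U - card (S x H)" using finU by (intro card_Diff_subset) (auto simp: S_def)
  finally have "16 * card {C \<in> W. \<not> match_sat k ?M C} \<le> 15 * card U" using xH(2) by linarith
  then have "card {C \<in> W. \<not> match_sat k ?M C} * 16 ^ Suc j \<le> 15 * card U * 16 ^ j" by simp
  also have "\<dots> \<le> 15 ^ Suc j * card W" using M(3) unfolding U_def by simp
  finally have "card {C \<in> W. \<not> match_sat k ?M C} * 16 ^ Suc j \<le> 15 ^ Suc j * card W" .
  moreover have "card (dom ?M) = Suc j" using x M(1,2) matching_finite by auto
  ultimately show ?case using matching_upd[OF M(1) x H] by blast
qed

section \<open>The exponential lower bound\<close>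

text \<open>Extension variables are set to true throughout.\<close>

definition val :: "nat \<Rightarrow> (nat \<rightharpoonup> nat set) \<Rightarrow> nat \<times> nat \<Rightarrow> bool" where
  "val k M v \<longleftrightarrow> v \<in> bvars k \<longrightarrow> snd v \<in> the (M (fst v))"

text \<open>The domain condition keeps \<open>the (M x)\<close> from giving an unmatched pigeon an
  arbitrary hole.\<close>

definition falsified :: "nat \<Rightarrow> (nat \<rightharpoonup> nat set) \<Rightarrow> (nat \<times> nat) clause \<Rightarrow> bool" where
  "falsified k M C \<longleftrightarrow>
    (\<forall>l\<in>C. (atm l \<in> bvars k \<longrightarrow> fst (atm l) \<in> dom M) \<and> \<not> holds (val k M) l)"

lemma falsified_subset: "falsified k M C \<Longrightarrow> D \<subseteq> C \<Longrightarrow> falsified k M D"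
  unfolding falsified_def by blast

text \<open>Serves in both directions: to enlarge a matching, and to cut it down to the pigeons that
  matter.\<close>

lemma falsified_agree:
  assumes "falsified k M C" "\<And>x. x \<in> touched k C \<Longrightarrow> M' x = M x"
  shows "falsified k M' C"
proof -
  have "(atm l \<in> bvars k \<longrightarrow> fst (atm l) \<in> dom M') \<and> \<not> holds (val k M') l" if "l \<in> C" for l
  proof -
    have "M' (fst (atm l)) = M (fst (atm l))" if "atm l \<in> bvars k"
      using that \<open>l \<in> C\<close> by (intro assms(2)) (auto simp: touched_def)
    then have "val k M' (atm l) = val k M (atm l)" by (auto simp: val_def)
    then have "holds (val k M') l = holds (val k M) l" by (cases l) auto
    then show ?thesis using assms(1) that \<open>atm l \<in> bvars k \<Longrightarrow> _\<close> unfolding falsified_def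
      by (metis domIff)
  qed
  then show ?thesis unfolding falsified_def by blast
qed

lemma falsified_touched: "falsified k M C \<Longrightarrow> touched k C \<subseteq> dom M"
  unfolding falsified_def touched_def by auto

lemma falsified_map_le: "falsified k M C \<Longrightarrow> M \<subseteq>\<^sub>m M' \<Longrightarrow> falsified k M' C"
  using falsified_agree[of k M C M'] falsified_touched[of k M C] unfolding map_le_def by (metis subsetD)

lemma match_sat_not_falsified:
  assumes "matching k R" "match_sat k R C" "R \<subseteq>\<^sub>m M"
  shows "\<not> falsified k M C"
proof
  assume f: "falsified k M C"
  from assms(2) obtain x H lit l where *: "R x = Some H" "lit \<in> C" "l \<in> {1..k}" "atm lit = (x, l)"
    "holds (\<lambda>_. l \<in> H) lit"
    unfolding match_sat_def bit_sat_def by blast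
  have "x \<in> dom R" using *(1) by blast
  then have "x \<in> {1..2 ^ k + 1}" using assms(1) unfolding matching_def by blast
  then have "(x, l) \<in> bvars k" using *(3) by (simp add: bvars_def)
  moreover have "M x = Some H" using assms(3) *(1) \<open>x \<in> dom R\<close> by (metis map_le_def)
  ultimately have "val k M (x, l) \<longleftrightarrow> l \<in> H" by (simp add: val_def)
  then have "holds (val k M) lit" using *(4,5) by (cases lit) auto
  then show False using f *(2) unfolding falsified_def by blast
qed

lemma BPHP_not_falsified:
  assumes M: "matching k M" and C: "C \<in> BPHP_pow k" and k: "k \<ge> 1"
  shows "\<not> falsified k M C"
proof
  assume f: "falsified k M C"
  obtain x y h where xy: "x \<in> {1..2 ^ k + 1}" "y \<in> {1..2 ^ k + 1}" "x \<noteq> y"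
    and eq: "C = (\<lambda>l. lit_neq (x, l) (h l)) ` {1..k} \<union> (\<lambda>l. lit_neq (y, l) (h l)) ` {1..k}"
    using C by (elim BPHP_powE)
  have *: "\<exists>H. M t = Some H \<and> (\<forall>l\<in>{1..k}. l \<in> H \<longleftrightarrow> h l)" if t: "t = x \<or> t = y" for t
  proof -
    have lit: "t \<in> dom M \<and> (val k M (t, l) \<longleftrightarrow> h l)" if "l \<in> {1..k}" for l
    proof -
      have "lit_neq (t, l) (h l) \<in> C" "(t, l) \<in> bvars k"
        using t that xy unfolding eq bvars_def by auto
      then show ?thesis using f unfolding falsified_def by fastforce
    qed
    have "1 \<in> {1..k}" using k by simp
    then obtain H where H: "M t = Some H" using lit by blast
    moreover have "val k M (t, l) \<longleftrightarrow> l \<in> H" if "l \<in> {1..k}" for l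
      using that t xy H by (auto simp: val_def bvars_def)
    ultimately show ?thesis using lit by blast
  qed
  obtain H where H: "M x = Some H" "\<forall>l\<in>{1..k}. l \<in> H \<longleftrightarrow> h l" using * by blast
  obtain K where K: "M y = Some K" "\<forall>l\<in>{1..k}. l \<in> K \<longleftrightarrow> h l" using * by blast
  have "H \<subseteq> {1..k}" "K \<subseteq> {1..k}" using M H(1) K(1) unfolding matching_def ran_def by blast+
  then have "H = K" using H(2) K(2) by blast
  then have "M x = M y" using H(1) K(1) by simp
  then have "x = y" using M H(1) K(1) unfolding matching_def by (metis domI inj_onD)
  with xy(3) show False by blast
qed

text \<open>Matching the pigeon of the pivot decides the pivot and thereby which premise is
  falsified. A pivot outside \<open>bvars k\<close> costs no pigeon, its value being fixed.\<close>

lemma resolvent_falsified: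
  assumes "resolvent C1 C2 R" "matching k M" "falsified k M R" "card (dom M) < 2 ^ k"
  shows "\<exists>M'. matching k M' \<and> M \<subseteq>\<^sub>m M' \<and> card (dom M') \<le> Suc (card (dom M)) \<and>
    (falsified k M' C1 \<or> falsified k M' C2)"
proof -
  obtain v C D where *: "C1 = insert (Pos v) C" "C2 = insert (Neg v) D" "R = C \<union> D"
    using assms(1) unfolding resolvent_def by blast
  have "\<exists>M'. matching k M' \<and> M \<subseteq>\<^sub>m M' \<and> (v \<in> bvars k \<longrightarrow> fst v \<in> dom M') \<and>
      card (dom M') \<le> Suc (card (dom M))"
  proof (cases "v \<in> bvars k")
    case True
    then have "fst v \<in> {1..2 ^ k + 1}" by (auto simp: bvars_def)
    then show ?thesis using matching_extend[OF assms(2,4)] by blast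
  next
    case False
    then show ?thesis using assms(2) by (intro exI[of _ M]) auto
  qed
  then obtain M' where M': "matching k M'" "M \<subseteq>\<^sub>m M'" "v \<in> bvars k \<longrightarrow> fst v \<in> dom M'"
    "card (dom M') \<le> Suc (card (dom M))" by blast
  have "falsified k M' (C \<union> D)" using falsified_map_le[OF assms(3) M'(2)] *(3) by simp
  then have "falsified k M' C1 \<or> falsified k M' C2"
    using M'(3) unfolding * falsified_def by (cases "val k M' v") auto
  with M' show ?thesis by blast
qed

lemma SBC_minus_lower_bound:
  assumes k: "k \<ge> 1" and q: "2 ^ k = 4 * q"
    and fresh: "ext_vars (fst (E (BPHP_pow k))) \<inter> bvars k = {}"
    and P: "SBC_minus_proof (guarded E (BPHP_pow k)) P"
  shows "16 ^ q \<le> 15 ^ q * length P"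
proof (rule ccontr)
  assume small: "\<not> 16 ^ q \<le> 15 ^ q * length P"
  let ?\<Gamma> = "BPHP_pow k" and ?G = "guarded E (BPHP_pow k)" and ?F = "last P"
  have proof_P: "proof_by SBC_rule ?G P" and nv: "no_new_vars ?G P"
    using P unfolding SBC_minus_proof_def by auto
  have "P \<noteq> []" using proof_P by auto
  have reach: "reach SBC_rule (length P - 1) ?G ?F" using proof_by_imp_reach[OF proof_P] .
  have ne: "vars ?\<Gamma> \<noteq> {}" unfolding vars_BPHP_pow bvars_def using k by auto
  have fresh': "ext_vars (fst (E ?\<Gamma>)) \<inter> vars ?\<Gamma> = {}" using fresh by (simp add: vars_BPHP_pow)
  have varsF: "vars ?F \<subseteq> bvars k \<union> ext_vars (fst (E ?\<Gamma>))"
    using nv \<open>P \<noteq> []\<close> vars_guarded[of ?\<Gamma> E, OF is_formula_BPHP_pow ne fresh'] vars_BPHP_pow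
    unfolding no_new_vars_def by auto
  \<comment> \<open>Initial clauses are left out: they satisfy the invariant without \<rho>, and
    only added clauses are bounded by the proof length.\<close>
  define W where "W = {C \<in> ?F - ?G. 2 * q \<le> card (touched k C)}"
  have W: "finite W" "card W \<le> length P"
  proof -
    have "W \<subseteq> ?F - ?G" by (auto simp: W_def)
    then show "finite W" "card W \<le> length P"
      using reach_card[OF reach] card_mono[of "?F - ?G" W] finite_subset by fastforce+
  qed
  obtain \<rho> where \<rho>: "matching k \<rho>" "card (dom \<rho>) = q"
    "card {C \<in> W. \<not> match_sat k \<rho> C} * 16 ^ q \<le> 15 ^ q * card W"
    using greedy_matching[OF q W(1), of q] unfolding W_def by blast
  have "card {C \<in> W. \<not> match_sat k \<rho> C} = 0"
  proof (rule ccontr)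
    assume "card {C \<in> W. \<not> match_sat k \<rho> C} \<noteq> 0"
    then have "1 * 16 ^ q \<le> card {C \<in> W. \<not> match_sat k \<rho> C} * 16 ^ q" by (intro mult_le_mono1) simp
    also note \<rho>(3)
    also have "15 ^ q * card W \<le> 15 ^ q * length P" using W(2) by simp
    finally show False using small by simp
  qed
  then have \<rho>W: "match_sat k \<rho> C" if "C \<in> W" for C using that W(1) by simp
  \<comment> \<open>\<open>3 * q\<close> is \<open>q\<close> for \<rho>, at most
    \<open>2 * q - 1\<close> for a narrow clause, and one for the pigeon of a pivot.\<close>
  define Q where "Q C \<longleftrightarrow>
    (\<forall>M. matching k M \<and> \<rho> \<subseteq>\<^sub>m M \<and> card (dom M) \<le> 3 * q \<longrightarrow> \<not> falsified k M C)" for C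
  have init: "Q C" if C: "C \<in> ?G" for C
  proof -
    obtain D where D: "D \<in> ?\<Gamma>" "D \<subseteq> C" using C unfolding guarded_iff by blast
    then show ?thesis unfolding Q_def using BPHP_not_falsified[OF _ D(1) k] falsified_subset by blast
  qed
  have "\<forall>C\<in>?F. Q C"
  proof (rule reach_invariant[OF reach init])
    fix F0 C assume F0: "?G \<subseteq> F0" "\<forall>D\<in>F0. Q D" and rule: "SBC_rule F0 C" and C: "C \<in> ?F"
    show "Q C"
    proof (cases "C \<in> ?G \<or> C \<in> W")
      case True
      then show ?thesis using init \<rho>W match_sat_not_falsified[OF \<rho>(1)] unfolding Q_def by blast
    next
      case False
      then have narrow: "card (touched k C) < 2 * q" using C unfolding W_def by auto
      from rule consider
        (res) C1 C2 where "C1 \<in> F0" "C2 \<in> F0" "resolvent C1 C2 C"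
        | (weak) D where "D \<in> F0" "D \<subseteq> C" | (SBC) L where "is_SBC F0 C L"
        unfolding SBC_rule_def resolution_rule_def weakening_rule_def by blast
      then show ?thesis
      proof cases
        case res
        show ?thesis unfolding Q_def
        proof (intro allI impI notI)
          fix M assume M: "matching k M \<and> \<rho> \<subseteq>\<^sub>m M \<and> card (dom M) \<le> 3 * q" and f: "falsified k M C"
          \<comment> \<open>\<open>M\<close> may already be at the bound; forgetting the pigeons
            that neither \<rho> nor \<open>C\<close> needs makes room for the pivot.\<close>
          define M1 where "M1 = M |` (dom \<rho> \<union> touched k C)"
          have M1: "matching k M1" unfolding M1_def using M matching_restrict by blast
          have "\<rho> \<subseteq>\<^sub>m M1" using M unfolding M1_def map_le_def by simp
          have f1: "falsified k M1 C" by (rule falsified_agree[OF f]) (simp add: M1_def)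
          have "dom M1 \<subseteq> dom \<rho> \<union> touched k C" by (auto simp: M1_def)
          then have "card (dom M1) \<le> card (dom \<rho> \<union> touched k C)"
            using matching_finite[OF \<rho>(1)] finite_touched by (intro card_mono) auto
          also have "\<dots> \<le> card (dom \<rho>) + card (touched k C)" by (rule card_Un_le)
          finally have lt: "card (dom M1) < 3 * q" using \<rho>(2) narrow by linarith
          then have "card (dom M1) < 2 ^ k" using q by linarith
          from resolvent_falsified[OF res(3) M1 f1 this] obtain M2 where
            M2: "matching k M2" "M1 \<subseteq>\<^sub>m M2" "card (dom M2) \<le> Suc (card (dom M1))"
              "falsified k M2 C1 \<or> falsified k M2 C2" by blast
          have "\<rho> \<subseteq>\<^sub>m M2" using \<open>\<rho> \<subseteq>\<^sub>m M1\<close> M2(2) by (rule map_le_trans)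
          moreover have "card (dom M2) \<le> 3 * q" using M2(3) lt by linarith
          ultimately have "\<not> falsified k M2 C1" "\<not> falsified k M2 C2"
            using F0(2) res(1,2) M2(1) unfolding Q_def by blast+
          with M2(4) show False by blast
        qed
      next
        case weak
        then show ?thesis using F0(2) falsified_subset unfolding Q_def by blast
      next
        case SBC
        \<comment> \<open>A set-blocked clause turns out to mention every pigeon, so narrowness
          rules this case out.\<close>
        then obtain l where l: "l \<in> L" "l \<in> C" unfolding is_SBC_def by blast
        have "atm l \<notin> ext_vars (fst (E ?\<Gamma>))"
          using SBC_guarded_not_ext_var[OF SBC F0(1) l(1) unsatisfiable_BPHP_pow is_formula_BPHP_pow fresh'] .
        moreover have "atm l \<in> vars ?F" using l(2) C unfolding vars_def by blast
        ultimately have "atm l \<in> bvars k" using varsF by blast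
        moreover have "?\<Gamma> \<subseteq> F0" using F0(1) by (auto simp: guarded_def)
        ultimately have "{1..2 ^ k + 1} \<subseteq> touched k C" using SBC_BPHP_touched[OF SBC _ l(1)] by blast
        from card_mono[OF finite_touched this] have "4 * q + 1 \<le> card (touched k C)" using q by simp
        with narrow show ?thesis by simp
      qed
    qed
  qed
  moreover have "{} \<in> ?F" by (rule last_proof_by[OF proof_P])
  ultimately have "Q {}" by blast
  then have "\<not> falsified k \<rho> {}" unfolding Q_def using \<rho> by simp
  then show False by (simp add: falsified_def)
qed

text \<open>Covers \<open>k = 1\<close>, where \<open>2 ^ k\<close> is not a multiple of 4 and the
  general bound does not apply.\<close>

lemma two_le_length_guarded_proof:
  assumes "proof_by S (guarded E (BPHP_pow k)) P" "k \<ge> 1"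
  shows "2 \<le> length P"
proof -
  have "{} \<notin> BPHP_pow k" using assms(2) by (auto elim: BPHP_powE)
  then have "{} \<notin> guarded E (BPHP_pow k)" by (simp add: guarded_iff)
  with assms(1) show ?thesis
    by (cases P; cases "tl P") auto
qed

lemma greatest_power:
  assumes "2 \<le> n"
  defines "k \<equiv> GREATEST k. 2 ^ k \<le> (n::nat)"
  shows "1 \<le> k" "2 ^ k \<le> n" "n < 2 * 2 ^ k"
proof -
  let ?P = "\<lambda>j::nat. 2 ^ j \<le> n"
  have bound: "\<And>j. ?P j \<Longrightarrow> j \<le> n" using less_exp order.strict_trans2 less_imp_le by blast
  have one: "?P 1" using assms(1) by simp
  show "2 ^ k \<le> n" unfolding k_def using one bound by (rule GreatestI_nat)
  show "1 \<le> k" unfolding k_def using one bound by (rule Greatest_le_nat)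
  have "\<not> ?P (Suc k)"
  proof
    assume "?P (Suc k)"
    then have "Suc k \<le> k" unfolding k_def using bound by (rule Greatest_le_nat)
    then show False by simp
  qed
  then show "n < 2 * 2 ^ k" by simp
qed

theorem theorem24:
  fixes E :: "(nat \<times> nat) formula \<Rightarrow> (nat \<times> nat) extension \<times> (nat \<times> nat) formula list"
  assumes "min_ER_choice E"
  shows "(\<exists>c::nat. \<forall>n\<ge>2. \<exists>P. RAT_minus_proof (guarded E (BPHP n)) P \<and> length P \<le> n ^ c) \<and>
         (\<exists>c::real. c > 0 \<and>
            (\<forall>n\<ge>2. \<forall>P. SBC_minus_proof (guarded E (BPHP n)) P \<longrightarrow>
               2 powr (c * real n) \<le> real (length P)))"
proof -
  have min: "ER_proof (BPHP_pow k) (E (BPHP_pow k))"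
      "ER_proof (BPHP_pow k) \<pi> \<Longrightarrow> ER_size (E (BPHP_pow k)) \<le> ER_size \<pi>" for k \<pi>
  proof -
    have "is_arg_min ER_size (ER_proof (BPHP_pow k)) (E (BPHP_pow k))"
      using assms is_formula_BPHP_pow unsatisfiable_BPHP_pow
      unfolding min_ER_choice_def min_ER_proof_def by blast
    then show "ER_proof (BPHP_pow k) (E (BPHP_pow k))"
        "ER_proof (BPHP_pow k) \<pi> \<Longrightarrow> ER_size (E (BPHP_pow k)) \<le> ER_size \<pi>"
      unfolding is_arg_min_def not_ex de_Morgan_conj not_less by blast+
  qed
  have upper: "\<exists>P. RAT_minus_proof (guarded E (BPHP n)) P \<and> length P \<le> n ^ 42" if "2 \<le> n" for n
  proof -
    define k :: nat where "k = (GREATEST k. 2 ^ k \<le> n)"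
    note kn = greatest_power[OF that, folded k_def]
    have BPHP: "BPHP n = BPHP_pow k" by (simp add: BPHP_def k_def)
    obtain f where "bij_betw f {0..<card (Pow {1..k})} (Pow {1..k})"
      using ex_bij_betw_nat_finite[of "Pow {1..k}"] by auto
    then have "bij_betw f {..<2 ^ k} (Pow {1..k})" by (simp add: card_Pow lessThan_atLeast0)
    then interpret bit_pigeonhole k f using kn(1) by unfold_locales
    obtain \<pi> where "ER_proof (BPHP_pow k) \<pi>" "ER_size \<pi> \<le> N ^ 40" using ER_proof_BPHP_pow by blast
    then have size: "ER_size (E (BPHP_pow k)) \<le> N ^ 40" using min(2) order_trans by blast
    have "vars (BPHP_pow k) \<noteq> {}" using kn(1) by (auto simp: vars_BPHP_pow bvars_def)
    then obtain P where P: "RAT_minus_proof (guarded E (BPHP_pow k)) P"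
      "length P \<le> 3 * ER_size (E (BPHP_pow k))"
      using guarded_RAT_minus_proof[of "BPHP_pow k" E] min(1) is_formula_BPHP_pow by blast
    have "2 \<le> N" using power_increasing[OF kn(1), of "2::nat"] by (simp add: N_def)
    then have "2 * 2 \<le> N * N" by (intro mult_le_mono)
    \<comment> \<open>The constant factor 3 is absorbed into two more powers of \<open>N\<close>, as
      \<open>4 \<le> N * N\<close>.\<close>
    have "length P \<le> 4 * N ^ 40" using P(2) size by linarith
    also have "\<dots> \<le> (N * N) * N ^ 40" using \<open>2 * 2 \<le> N * N\<close> by (intro mult_le_mono) simp_all
    also have "\<dots> = N ^ 42" by (simp add: eval_nat_numeral)
    also have "\<dots> \<le> n ^ 42" using kn(2) unfolding N_def by (rule power_mono) simp
    finally show ?thesis using P(1) unfolding BPHP by blast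
  qed
  \<comment> \<open>The proof has size at least \<open>(16 / 15) ^ q\<close>, and
    \<open>n < 2 * 2 ^ k = 8 * q\<close> accounts for the division by 8.\<close>
  have lower: "2 powr (log 2 (16 / 15) / 8 * real n) \<le> real (length P)"
    if "2 \<le> n" "SBC_minus_proof (guarded E (BPHP n)) P" for n P
  proof -
    define k :: nat where "k = (GREATEST k. 2 ^ k \<le> n)"
    note k = greatest_power[OF that(1), folded k_def]
    have P: "SBC_minus_proof (guarded E (BPHP_pow k)) P" using that(2) by (simp add: BPHP_def k_def)
    have log: "0 < log 2 (16 / 15 :: real)" "log 2 (16 / 15 :: real) \<le> 1" by simp_all
    show ?thesis
    proof (cases "k = 1")
      case True
      have "real n \<le> 8" using k(3) True by simp
      then have "log 2 (16 / 15) / 8 * real n \<le> 1"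
        using log mult_mono[of "log 2 (16 / 15)" 1 "real n" 8] by simp
      then have "2 powr (log 2 (16 / 15) / 8 * real n) \<le> 2 powr 1" by (rule powr_mono) simp
      moreover have "2 \<le> length P"
        using two_le_length_guarded_proof P k(1) unfolding SBC_minus_proof_def by blast
      ultimately show ?thesis by simp
    next
      case False
      define q :: nat where "q = 2 ^ (k - 2)"
      have "k = k - 2 + 2" using False k(1) by simp
      then have q: "2 ^ k = 4 * q" unfolding q_def by (metis mult.commute power2_eq_square power_add numeral_Bit0 mult_2 mult_2_right)
      have "is_extension (BPHP_pow k) (fst (E (BPHP_pow k)))"
        using min(1)[of k] unfolding ER_proof_def by (auto simp: case_prod_beta)
      then have "ext_vars (fst (E (BPHP_pow k))) \<inter> bvars k = {}"
        using is_extension_fresh[of "BPHP_pow k"] unfolding vars_BPHP_pow[symmetric] by blast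
      from SBC_minus_lower_bound[OF k(1) q this P]
      have "real (16 ^ q) \<le> real (15 ^ q * length P)" by (rule of_nat_mono)
      then have "(16 / 15) ^ q \<le> real (length P)" (is ?bound) by (simp add: power_divide field_simps)
      have "log 2 (16 / 15) / 8 * real n \<le> log 2 (16 / 15) * real q"
      proof -
        have "real n \<le> 8 * real q" using k(3) q by simp
        then show ?thesis using log by (simp add: field_simps)
      qed
      then have "2 powr (log 2 (16 / 15) / 8 * real n) \<le> 2 powr (log 2 (16 / 15) * real q)"
        by (rule powr_mono) simp
      also have "\<dots> = (16 / 15) ^ q" by (simp add: powr_powr[symmetric] powr_realpow)
      also note \<open>?bound\<close>
      finally show ?thesis .
    qed
  qed
  have "0 < log 2 (16 / 15 :: real) / 8" by simp
  then show ?thesis using upper lower by blast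
qed

end
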